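(* Let $Y$ be the del Pezzo surface of degree $5$ over $\mathbb{C}$, embedded anticanonically in $\mathbb{P}^5$ by the basis $s_{12},s_{13},s_{21},s_{23},s_{31},s_{32}$ of $V=H^0(Y,\mathcal{O}_Y(-K_Y))$. Let $A=(A_{I,J})$ be the antisymmetric $6\times 6$ matrix of linear forms, with rows and columns indexed, in this order, by $I,J\in\{12,13,21,23,31,32\}$, whose entries above the diagonal are \begin{align*} A_{12,13}&=s_{21}+s_{23}-s_{31}-s_{32}, & A_{12,21}&=s_{12}+s_{31}-s_{32}-s_{21}, & A_{12,23}&=-s_{13}-s_{21},\\ A_{12,31}&=s_{13}+s_{32}, & A_{12,32}&=s_{21}+s_{32}-s_{12}-s_{23}, & A_{13,21}&=s_{12}+s_{23},\\ A_{13,23}&=s_{31}+s_{23}-s_{13}-s_{32}, & A_{13,31}&=s_{13}+s_{21}-s_{23}-s_{31}, & A_{13,32}&=-s_{12}-s_{31},\\ A_{21,23}&=s_{12}+s_{13}-s_{32}-s_{31}, & A_{21,31}&=s_{12}-s_{21}+s_{31}-s_{13}, & A_{21,32}&=s_{23}+s_{31},\\ A_{23,31}&=-s_{21}-s_{32}, & A_{23,32}&=s_{23}+s_{12}-s_{13}-s_{32}, & A_{31,32}&=s_{12}+s_{13}-s_{21}-s_{23}. \end{align*} Then $A$ is $\mathfrak{S}_5$-equivariant, i.e. the element $\sum_{I,J}(Q_I\wedge Q_J)\otimes A_{I,J}$ of $\Lambda^2 W'\otimes (V\otimes\epsilon)$ is $\mathfrak{S}_5$-invariant, and the homogeneous ideal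 of $Y$ in $\operatorname{Sym}(V)=\mathbb{C}[s_{12},s_{13},s_{21},s_{23},s_{31},s_{32}]$ is generated by the fifteen $4\times 4$ Pfaffians of $A$.
   Context: Let $p_1=(1:0:0)$, $p_2=(0:1:0)$, $p_3=(0:0:1)$, $p_4=(1:1:1)$ in $\mathbb{P}^2$ and let $Y$ be the blow-up of $\mathbb{P}^2$ at $p_1,\dots,p_4$. The space $V=H^0(Y,\mathcal{O}_Y(-K_Y))$ is identified with the 6-dimensional space of cubic forms in $x_1,x_2,x_3$ vanishing at $p_1,\dots,p_4$ (a cubic $P$ corresponds to $P\,(dx_1\wedge dx_2\wedge dx_3)^{-1}$). For $\{i,j,k\}=\{1,2,3\}$ put $s_{ij}=x_ix_j(x_j-x_k)$; these six cubics form a basis of $V$. Put $\sigma_{ij}=\eta\,(s_{ik}-s_{ki}-s_{jk})\in V$, where $\eta$ is the sign of the permutation $1\mapsto i,\,2\mapsto j,\,3\mapsto k$. In $\operatorname{Sym}^2(V)$ put $Q_{ij}=s_{ij}\sigma_{ij}$; the six $Q_{ij}$ are linearly independent and $W'\subset \operatorname{Sym}^2(V)$ denotes their span. $\operatorname{Aut}(Y)\cong\mathfrak{S}_5$, and the induced linear (left) action on $V$ is generated as follows: $\tau\in\mathfrak{S}_3$ acts by $s_{ij}\mapsto \operatorname{sgn}(\tau)s_{\tau(i)\tau(j)}$; $(3,4)$ acts by $s_{12}\mapsto\sigma_{31}$, $s_{13}\mapsto s_{23}$, $s_{21}\mapsto-\sigma_{32}$, $s_{23}\mapsto s_{13}$,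 $s_{31}\mapsto-\sigma_{12}$, $s_{32}\mapsto\sigma_{21}$; $(4,5)$ acts by $s_{ij}\mapsto s_{ik}$ for $\{i,j,k\}=\{1,2,3\}$. The induced action on $\operatorname{Sym}^2(V)$ preserves $W'$. $\epsilon$ denotes the sign character of $\mathfrak{S}_5$; thus on $V\otimes\epsilon$ an element $g$ acts as $\operatorname{sgn}(g)$ times its action on $V$. The $4\times4$ Pfaffians of $A$ are the Pfaffians of its $15$ principal $4\times4$ submatrices. *)

theory Defs
  imports "HOL-Analysis.Analysis" "HOL-Algebra.Group_Action" "HOL-Algebra.Sym_Groups" "HOL-Library.Poly_Mapping"
begin

section \<open>The blow-up and its anticanonical sections\<close>

datatype idx = I12 | I13 | I21 | I23 | I31 | I32

lemma UNIV_idx: "(UNIV :: idx set) = {I12, I13, I21, I23, I31, I32}"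
  using idx.exhaust by auto

instance idx :: finite
  by standard (simp add: UNIV_idx)

primrec ends :: "idx \<Rightarrow> nat \<times> nat" where
  "ends I12 = (1, 2)"
| "ends I13 = (1, 3)"
| "ends I21 = (2, 1)"
| "ends I23 = (2, 3)"
| "ends I31 = (3, 1)"
| "ends I32 = (3, 2)"

text \<open>Inverse of \<^const>\<open>ends\<close>; only used for distinct \<open>i, j \<in> {1, 2, 3}\<close>.\<close>

definition ix :: "nat \<Rightarrow> nat \<Rightarrow> idx" where
  "ix i j =
     (if i = 1 then (if j = 2 then I12 else I13)
      else if i = 2 then (if j = 1 then I21 else I23)
      else (if j = 1 then I31 else I32))"

text \<open>The index \<open>k\<close> with \<open>{i, j, k} = {1, 2, 3}\<close>.\<close>

definition third :: "nat \<Rightarrow> nat \<Rightarrow> nat" where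
  "third i j = 6 - i - j"

text \<open>
  The cubic form \<open>s\<^sub>i\<^sub>j = x\<^sub>i x\<^sub>j (x\<^sub>j - x\<^sub>k)\<close>, as a function on homogeneous coordinates.
  The index type \<open>3\<close> of \<open>complex ^ 3\<close> has elements \<open>1, 2, 3\<close> (with \<open>3 = 0\<close>).
\<close>

definition cubic :: "idx \<Rightarrow> complex ^ 3 \<Rightarrow> complex" where
  "cubic I x =
     (let (i, j) = ends I; k = third i j
      in x $ of_nat i * x $ of_nat j * (x $ of_nat j - x $ of_nat k))"

definition base_point :: "nat \<Rightarrow> complex ^ 3" where
  "base_point i =
     (if i = 1 then vector [1, 0, 0]
      else if i = 2 then vector [0, 1, 0]
      else if i = 3 then vector [0, 0, 1]
      else vector [1, 1, 1])"

definition on_line :: "complex ^ 3 \<Rightarrow> complex ^ 3 \<Rightarrow> bool" where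
  "on_line l x \<longleftrightarrow> (\<Sum>k\<in>UNIV. l $ k * x $ k) = 0"

text \<open>
  The blow-up of the plane at \<open>p\<^sub>1, \<dots>, p\<^sub>4\<close>: the pairs of a point \<open>x\<close> and, for each \<open>i\<close>, a line
  \<open>l\<^sub>i\<close> through \<open>p\<^sub>i\<close> and \<open>x\<close>, i.e. the fibre product over the plane of the four incidence
  varieties \<open>{(x, l). p\<^sub>i \<in> l, x \<in> l}\<close> that are the blow-ups at the single points.  Points and
  lines are given by (all of) their homogeneous coordinate vectors.
\<close>

definition blowup :: "((complex ^ 3) \<times> (nat \<Rightarrow> complex ^ 3)) set" where
  "blowup = {(x, l). x \<noteq> 0 \<and>
     (\<forall>i\<in>{1..4}. l i \<noteq> 0 \<and> on_line (l i) (base_point i) \<and> on_line (l i) x)}"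

text \<open>
  \<open>anticanonical q z\<close>: \<open>z\<close> is the vector of values at \<open>q\<close> of the sections \<open>s\<^sub>I\<close> of the
  anticanonical bundle \<open>O(3H - E\<^sub>1 - \<dots> - E\<^sub>4)\<close>, in some trivialisation near \<open>q\<close>.  Off the
  exceptional curves these are the values of the cubics.  At the point of \<open>E\<^sub>i\<close> given by the
  line \<open>l\<^sub>i\<close>, with \<open>v\<close> a second point of \<open>l\<^sub>i\<close>, the curve \<open>t \<mapsto> p\<^sub>i + t v\<close> meets \<open>E\<^sub>i\<close>
  transversally at \<open>t = 0\<close>; dividing the cubic by the equation \<open>t\<close> of \<open>E\<^sub>i\<close> gives its
  derivative at \<open>t = 0\<close>.
\<close>

inductive anticanonical :: "(complex ^ 3) \<times> (nat \<Rightarrow> complex ^ 3) \<Rightarrow> (idx \<Rightarrow> complex) \<Rightarrow> bool" where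
  generic: "(\<And>i c. i \<in> {1..4} \<Longrightarrow> x \<noteq> c *s base_point i) \<Longrightarrow>
    anticanonical (x, l) (\<lambda>I. cubic I x)"
| exceptional: "i \<in> {1..4} \<Longrightarrow> x = c *s base_point i \<Longrightarrow>
    on_line (l i) v \<Longrightarrow> (\<And>a. v \<noteq> a *s base_point i) \<Longrightarrow>
    anticanonical (x, l) (\<lambda>I. deriv (\<lambda>t. cubic I (base_point i + t *s v)) 0)"

text \<open>
  The anticanonical image of the blow-up in \<open>\<P>\<^sup>5\<close>, as the set of homogeneous coordinate vectors
  of its points.  It is closed under nonzero scaling, since \<open>x\<close> and \<open>v\<close> above may be rescaled.
\<close>

definition delPezzo5 :: "(idx \<Rightarrow> complex) set" where
  "delPezzo5 = {z. \<exists>q\<in>blowup. anticanonical q z}"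


section \<open>The symmetric algebra and homogeneous ideals\<close>

text \<open>
  \<open>V\<close> is \<open>complex ^ idx\<close>, with the \<open>s\<^sub>i\<^sub>j\<close> as its standard basis, and \<open>Sym(V)\<close> is the polynomial
  ring in the six variables \<open>idx\<close>.
\<close>

type_synonym symV = "(idx \<Rightarrow>\<^sub>0 nat) \<Rightarrow>\<^sub>0 complex"

definition const :: "complex \<Rightarrow> symV" where
  "const c = Poly_Mapping.single 0 c"

definition var :: "idx \<Rightarrow> symV" where
  "var I = Poly_Mapping.single (Poly_Mapping.single I 1) 1"

definition lin :: "complex ^ idx \<Rightarrow> symV" where
  "lin v = (\<Sum>I\<in>UNIV. const (v $ I) * var I)"

definition peval :: "(idx \<Rightarrow> complex) \<Rightarrow> symV \<Rightarrow> complex" where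
  "peval z p = (\<Sum>m\<in>Poly_Mapping.keys p.
     Poly_Mapping.lookup p m * (\<Prod>I\<in>UNIV. z I ^ Poly_Mapping.lookup m I))"

definition homogeneous :: "nat \<Rightarrow> symV \<Rightarrow> bool" where
  "homogeneous d p \<longleftrightarrow>
     (\<forall>m\<in>Poly_Mapping.keys p. (\<Sum>I\<in>UNIV. Poly_Mapping.lookup m I) = d)"

text \<open>For the ring \<^typ>\<open>symV\<close> as a module over itself, \<^const>\<open>Modules.module.span\<close> is the
  generated ideal.\<close>

definition ideal_generated :: "symV set \<Rightarrow> symV set" where
  "ideal_generated = Modules.module.span (*)"

definition homogeneous_ideal :: "(idx \<Rightarrow> complex) set \<Rightarrow> symV set" where
  "homogeneous_ideal X =
     ideal_generated {p. (\<exists>d. homogeneous d p) \<and> (\<forall>z\<in>X. peval z p = 0)}"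


section \<open>The action of the symmetric group\<close>

definition s_vec :: "nat \<Rightarrow> nat \<Rightarrow> complex ^ idx" where
  "s_vec i j = axis (ix i j) 1"

definition eta :: "nat \<Rightarrow> nat \<Rightarrow> nat \<Rightarrow> complex" where
  "eta i j k = of_int (sign (id(1 := i, 2 := j, 3 := k)))"

definition sigma_vec :: "nat \<Rightarrow> nat \<Rightarrow> complex ^ idx" where
  "sigma_vec i j = (let k = third i j in eta i j k *s (s_vec i k - s_vec k i - s_vec j k))"

definition Q_quad :: "idx \<Rightarrow> symV" where
  "Q_quad I = (let (i, j) = ends I in lin (s_vec i j) * lin (sigma_vec i j))"

definition S5_action :: "((nat \<Rightarrow> nat) \<Rightarrow> complex ^ idx \<Rightarrow> complex ^ idx) \<Rightarrow> bool" where
  "S5_action \<rho> \<longleftrightarrow>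
     group_action (sym_group 5) UNIV \<rho> \<and>
     (\<forall>g\<in>carrier (sym_group 5). Vector_Spaces.linear (*s) (*s) (\<rho> g)) \<and>
     (\<forall>\<tau> i j. \<tau> permutes {1..3} \<longrightarrow> i \<in> {1..3} \<longrightarrow> j \<in> {1..3} \<longrightarrow> i \<noteq> j \<longrightarrow>
        \<rho> \<tau> (s_vec i j) = of_int (sign \<tau>) *s s_vec (\<tau> i) (\<tau> j)) \<and>
     \<rho> (Transposition.transpose 3 4) (s_vec 1 2) = sigma_vec 3 1 \<and>
     \<rho> (Transposition.transpose 3 4) (s_vec 1 3) = s_vec 2 3 \<and>
     \<rho> (Transposition.transpose 3 4) (s_vec 2 1) = - sigma_vec 3 2 \<and>
     \<rho> (Transposition.transpose 3 4) (s_vec 2 3) = s_vec 1 3 \<and>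
     \<rho> (Transposition.transpose 3 4) (s_vec 3 1) = - sigma_vec 1 2 \<and>
     \<rho> (Transposition.transpose 3 4) (s_vec 3 2) = sigma_vec 2 1 \<and>
     (\<forall>i j k. {i, j, k} = {1, 2, 3} \<longrightarrow> \<rho> (Transposition.transpose 4 5) (s_vec i j) = s_vec i k)"

text \<open>The algebra endomorphism of \<open>Sym(V)\<close> induced by a linear map \<open>f\<close> on \<open>V\<close>.\<close>

definition sym_map :: "(complex ^ idx \<Rightarrow> complex ^ idx) \<Rightarrow> symV \<Rightarrow> symV" where
  "sym_map f p = (\<Sum>m\<in>Poly_Mapping.keys p.
     const (Poly_Mapping.lookup p m) *
     (\<Prod>I\<in>UNIV. lin (f (axis I 1)) ^ Poly_Mapping.lookup m I))"

text \<open>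
  \<open>'a \<Rightarrow>\<^sub>0 complex\<close> is the complex vector space with basis \<open>'a\<close>; the tensor product of two such
  spaces is the one with basis \<open>'a \<times> 'b\<close>.
\<close>

definition tensor :: "('a \<Rightarrow>\<^sub>0 complex) \<Rightarrow> ('b \<Rightarrow>\<^sub>0 complex) \<Rightarrow> ('a \<times> 'b \<Rightarrow>\<^sub>0 complex)"
    (infixr "\<otimes>\<^sub>t" 75) where
  "u \<otimes>\<^sub>t v = (\<Sum>a\<in>Poly_Mapping.keys u. \<Sum>b\<in>Poly_Mapping.keys v.
     Poly_Mapping.single (a, b) (Poly_Mapping.lookup u a * Poly_Mapping.lookup v b))"

text \<open>The linear map \<open>F \<otimes> G\<close>, for linear \<open>F\<close> and \<open>G\<close>.\<close>

definition tensor_map ::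
  "(('a \<Rightarrow>\<^sub>0 complex) \<Rightarrow> ('c \<Rightarrow>\<^sub>0 complex)) \<Rightarrow> (('b \<Rightarrow>\<^sub>0 complex) \<Rightarrow> ('d \<Rightarrow>\<^sub>0 complex)) \<Rightarrow>
   ('a \<times> 'b \<Rightarrow>\<^sub>0 complex) \<Rightarrow> ('c \<times> 'd \<Rightarrow>\<^sub>0 complex)" where
  "tensor_map F G t = (\<Sum>(a, b)\<in>Poly_Mapping.keys t.
     Poly_Mapping.map ((*) (Poly_Mapping.lookup t (a, b)))
       (F (Poly_Mapping.single a 1) \<otimes>\<^sub>t G (Poly_Mapping.single b 1)))"

text \<open>The exterior square is embedded in the tensor square as the antisymmetric tensors.\<close>

definition wedge :: "('a \<Rightarrow>\<^sub>0 complex) \<Rightarrow> ('a \<Rightarrow>\<^sub>0 complex) \<Rightarrow> ('a \<times> 'a \<Rightarrow>\<^sub>0 complex)"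
    (infixr "\<and>\<^sub>t" 76) where
  "u \<and>\<^sub>t v = u \<otimes>\<^sub>t v - v \<otimes>\<^sub>t u"

text \<open>
  \<open>\<Lambda>\<^sup>2 W' \<otimes> (V \<otimes> \<epsilon>)\<close> is a subspace of \<open>Sym(V) \<otimes> Sym(V) \<otimes> Sym(V)\<close>, where \<open>V\<close> is the degree one
  part of the last factor.  The following is the action of \<open>g\<close> on it, the sign being the twist
  by \<open>\<epsilon>\<close>.
\<close>

type_synonym symV3 =
  "((idx \<Rightarrow>\<^sub>0 nat) \<times> (idx \<Rightarrow>\<^sub>0 nat)) \<times> (idx \<Rightarrow>\<^sub>0 nat) \<Rightarrow>\<^sub>0 complex"

definition twisted_action ::
  "((nat \<Rightarrow> nat) \<Rightarrow> complex ^ idx \<Rightarrow> complex ^ idx) \<Rightarrow> (nat \<Rightarrow> nat) \<Rightarrow> symV3 \<Rightarrow> symV3" where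
  "twisted_action \<rho> g =
     tensor_map (tensor_map (sym_map (\<rho> g)) (sym_map (\<rho> g)))
       (\<lambda>u. const (of_int (sign g)) * sym_map (\<rho> g) u)"


section \<open>The matrix and its Pfaffians\<close>

fun A_upper :: "idx \<Rightarrow> idx \<Rightarrow> complex ^ idx" where
  "A_upper I12 I13 = s_vec 2 1 + s_vec 2 3 - s_vec 3 1 - s_vec 3 2"
| "A_upper I12 I21 = s_vec 1 2 + s_vec 3 1 - s_vec 3 2 - s_vec 2 1"
| "A_upper I12 I23 = - s_vec 1 3 - s_vec 2 1"
| "A_upper I12 I31 = s_vec 1 3 + s_vec 3 2"
| "A_upper I12 I32 = s_vec 2 1 + s_vec 3 2 - s_vec 1 2 - s_vec 2 3"
| "A_upper I13 I21 = s_vec 1 2 + s_vec 2 3"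
| "A_upper I13 I23 = s_vec 3 1 + s_vec 2 3 - s_vec 1 3 - s_vec 3 2"
| "A_upper I13 I31 = s_vec 1 3 + s_vec 2 1 - s_vec 2 3 - s_vec 3 1"
| "A_upper I13 I32 = - s_vec 1 2 - s_vec 3 1"
| "A_upper I21 I23 = s_vec 1 2 + s_vec 1 3 - s_vec 3 2 - s_vec 3 1"
| "A_upper I21 I31 = s_vec 1 2 - s_vec 2 1 + s_vec 3 1 - s_vec 1 3"
| "A_upper I21 I32 = s_vec 2 3 + s_vec 3 1"
| "A_upper I23 I31 = - s_vec 2 1 - s_vec 3 2"
| "A_upper I23 I32 = s_vec 2 3 + s_vec 1 2 - s_vec 1 3 - s_vec 3 2"
| "A_upper I31 I32 = s_vec 1 2 + s_vec 1 3 - s_vec 2 1 - s_vec 2 3"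
| "A_upper _ _ = 0"

definition A_mat :: "idx \<Rightarrow> idx \<Rightarrow> symV" where
  "A_mat I J = lin (A_upper I J - A_upper J I)"

definition A_tensor :: symV3 where
  "A_tensor = (\<Sum>I\<in>UNIV. \<Sum>J\<in>UNIV. (Q_quad I \<and>\<^sub>t Q_quad J) \<otimes>\<^sub>t A_mat I J)"

definition pfaffian4 :: "idx \<Rightarrow> idx \<Rightarrow> idx \<Rightarrow> idx \<Rightarrow> symV" where
  "pfaffian4 I J K L = A_mat I J * A_mat K L - A_mat I K * A_mat J L + A_mat I L * A_mat J K"

definition idx_list :: "idx list" where
  "idx_list = [I12, I13, I21, I23, I31, I32]"

definition A_pfaffians :: "symV set" where
  "A_pfaffians =
     {pfaffian4 (idx_list ! a) (idx_list ! b) (idx_list ! c) (idx_list ! d) | a b c d.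
        a < b \<and> b < c \<and> c < d \<and> d < 6}"


section \<open>Existence of the action\<close>

text \<open>
  To see that \<^const>\<open>S5_action\<close> is satisfiable, \<open>V\<close> is identified with the antisymmetric \<open>5 \<times> 5\<close>
  matrices with zero row sums, on which \<open>g\<close> acts by permuting the indices and multiplying by
  its sign; \<open>pent v\<close> is the matrix corresponding to \<open>v\<close>, and \<open>unpent\<close> is the inverse.
\<close>

definition pent_upper :: "complex ^ idx \<Rightarrow> nat \<Rightarrow> nat \<Rightarrow> complex" where
  "pent_upper v a b =
    (if (a, b) = (1, 2) then - v$I12 + v$I13 + v$I21 - v$I23 + v$I31 - v$I32
     else if (a, b) = (1, 3) then v$I12 - v$I13 + v$I21 - v$I23 + v$I31 - v$I32
     else if (a, b) = (1, 4) then v$I12 + v$I13 - v$I21 + v$I23 - v$I31 + v$I32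
     else if (a, b) = (1, 5) then - v$I12 - v$I13 - v$I21 + v$I23 - v$I31 + v$I32
     else if (a, b) = (2, 3) then v$I12 - v$I13 + v$I21 - v$I23 - v$I31 + v$I32
     else if (a, b) = (2, 4) then - v$I12 + v$I13 + v$I21 + v$I23 + v$I31 - v$I32
     else if (a, b) = (2, 5) then - v$I12 + v$I13 - v$I21 - v$I23 + v$I31 - v$I32
     else if (a, b) = (3, 4) then v$I12 - v$I13 + v$I21 - v$I23 + v$I31 + v$I32
     else if (a, b) = (3, 5) then v$I12 - v$I13 + v$I21 - v$I23 - v$I31 - v$I32
     else if (a, b) = (4, 5) then v$I12 + v$I13 + v$I21 + v$I23 + v$I31 + v$I32
     else 0)"

definition pent :: "complex ^ idx \<Rightarrow> nat \<Rightarrow> nat \<Rightarrow> complex" where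
  "pent v a b = pent_upper v a b - pent_upper v b a"

primrec unpent_coord :: "(nat \<Rightarrow> nat \<Rightarrow> complex) \<Rightarrow> idx \<Rightarrow> complex" where
  "unpent_coord M I12 = (M 1 3 + M 1 4) / 2"
| "unpent_coord M I13 = (M 1 2 + M 1 4) / 2"
| "unpent_coord M I21 = (M 2 3 + M 2 4) / 2"
| "unpent_coord M I23 = (M 2 4 - M 1 2) / 2"
| "unpent_coord M I31 = (M 3 4 - M 2 3) / 2"
| "unpent_coord M I32 = (M 3 4 - M 1 3) / 2"

definition unpent :: "(nat \<Rightarrow> nat \<Rightarrow> complex) \<Rightarrow> complex ^ idx" where
  "unpent M = (\<chi> I. unpent_coord M I)"

definition std_action :: "(nat \<Rightarrow> nat) \<Rightarrow> complex ^ idx \<Rightarrow> complex ^ idx" where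
  "std_action g v =
     unpent (\<lambda>a b. of_int (sign g) * pent v (Hilbert_Choice.inv g a) (Hilbert_Choice.inv g b))"

lemma atLeastAtMost_1_5: "{1..5} = {1, 2, 3, 4, 5 :: nat}"
  by auto

lemma atLeastAtMost_1_3: "{1..3} = {1, 2, 3 :: nat}"
  by auto

lemma vec_idx_eq_iff:
  "v = w \<longleftrightarrow> v$I12 = w$I12 \<and> v$I13 = w$I13 \<and> v$I21 = w$I21 \<and> v$I23 = w$I23 \<and>
     v$I31 = w$I31 \<and> v$I32 = w$I32" for v w :: "complex ^ idx"
proof -
  have "(\<forall>I. v$I = w$I) \<longleftrightarrow> (\<forall>I\<in>{I12, I13, I21, I23, I31, I32}. v$I = w$I)"
    by (simp flip: UNIV_idx)
  then show ?thesis by (simp add: vec_eq_iff)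
qed

lemma pent_simps:
  "pent v 1 2 = - v$I12 + v$I13 + v$I21 - v$I23 + v$I31 - v$I32"
  "pent v 2 1 = - (- v$I12 + v$I13 + v$I21 - v$I23 + v$I31 - v$I32)"
  "pent v 1 3 = v$I12 - v$I13 + v$I21 - v$I23 + v$I31 - v$I32"
  "pent v 3 1 = - (v$I12 - v$I13 + v$I21 - v$I23 + v$I31 - v$I32)"
  "pent v 1 4 = v$I12 + v$I13 - v$I21 + v$I23 - v$I31 + v$I32"
  "pent v 4 1 = - (v$I12 + v$I13 - v$I21 + v$I23 - v$I31 + v$I32)"
  "pent v 1 5 = - v$I12 - v$I13 - v$I21 + v$I23 - v$I31 + v$I32"
  "pent v 5 1 = - (- v$I12 - v$I13 - v$I21 + v$I23 - v$I31 + v$I32)"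
  "pent v 2 3 = v$I12 - v$I13 + v$I21 - v$I23 - v$I31 + v$I32"
  "pent v 3 2 = - (v$I12 - v$I13 + v$I21 - v$I23 - v$I31 + v$I32)"
  "pent v 2 4 = - v$I12 + v$I13 + v$I21 + v$I23 + v$I31 - v$I32"
  "pent v 4 2 = - (- v$I12 + v$I13 + v$I21 + v$I23 + v$I31 - v$I32)"
  "pent v 2 5 = - v$I12 + v$I13 - v$I21 - v$I23 + v$I31 - v$I32"
  "pent v 5 2 = - (- v$I12 + v$I13 - v$I21 - v$I23 + v$I31 - v$I32)"
  "pent v 3 4 = v$I12 - v$I13 + v$I21 - v$I23 + v$I31 + v$I32"
  "pent v 4 3 = - (v$I12 - v$I13 + v$I21 - v$I23 + v$I31 + v$I32)"
  "pent v 3 5 = v$I12 - v$I13 + v$I21 - v$I23 - v$I31 - v$I32"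
  "pent v 5 3 = - (v$I12 - v$I13 + v$I21 - v$I23 - v$I31 - v$I32)"
  "pent v 4 5 = v$I12 + v$I13 + v$I21 + v$I23 + v$I31 + v$I32"
  "pent v 5 4 = - (v$I12 + v$I13 + v$I21 + v$I23 + v$I31 + v$I32)"
  "pent v a a = 0"
  by (simp_all add: pent_def pent_upper_def)

lemma unpent_pent: "unpent (pent v) = v"
  by (simp add: vec_idx_eq_iff unpent_def pent_def pent_upper_def)

lemma pent_antisym: "pent v a b = - pent v b a"
  by (simp add: pent_def)

lemma pent_row_sum: "a \<in> {1..5} \<Longrightarrow> (\<Sum>b\<in>{1..5}. pent v a b) = 0"
  unfolding atLeastAtMost_1_5 by (auto simp: pent_def pent_upper_def)

lemma pent_unpent:
  assumes anti: "\<And>a b. M a b = - M b a"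
    and row: "\<And>a. a \<in> {1..5} \<Longrightarrow> (\<Sum>b\<in>{1..5}. M a b) = 0"
    and "a \<in> {1..5}" "b \<in> {1..5}"
  shows "pent (unpent M) a b = M a b"
proof -
  have diag: "M a a = 0" for a
    using anti[of a a] by simp
  have lower: "M 2 1 = - M 1 2" "M 3 1 = - M 1 3" "M 4 1 = - M 1 4" "M 5 1 = - M 1 5"
    "M 3 2 = - M 2 3" "M 4 2 = - M 2 4" "M 5 2 = - M 2 5"
    "M 4 3 = - M 3 4" "M 5 3 = - M 3 5" "M 5 4 = - M 4 5"
    using anti by blast+
  have last: "M 1 5 = - M 1 2 - M 1 3 - M 1 4" "M 2 5 = M 1 2 - M 2 3 - M 2 4"
    "M 3 5 = M 1 3 + M 2 3 - M 3 4" "M 4 5 = M 1 4 + M 2 4 + M 3 4"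
  proof -
    have "M a 5 = - (M a 1 + M a 2 + M a 3 + M a 4)" if "a \<in> {1..5}" for a
    proof -
      have "(M a 1 + M a 2 + M a 3 + M a 4) + M a 5 = 0"
        using row[OF that] unfolding atLeastAtMost_1_5 by (simp add: add_ac)
      then show ?thesis by (simp only: add_eq_0_iff)
    qed
    from this[of 1] this[of 2] this[of 3] this[of 4]
    show "M 1 5 = - M 1 2 - M 1 3 - M 1 4" "M 2 5 = M 1 2 - M 2 3 - M 2 4"
      "M 3 5 = M 1 3 + M 2 3 - M 3 4" "M 4 5 = M 1 4 + M 2 4 + M 3 4"
      by (simp_all add: diag lower del: One_nat_def)
  qed
  show ?thesis
    using assms(3,4) unfolding atLeastAtMost_1_5
    by (elim insertE emptyE)
       (simp_all add: pent_simps unpent_def diag lower last field_simps del: One_nat_def)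
qed

lemma pent_std_action:
  assumes g: "g permutes {1..5}" and ab: "a \<in> {1..5}" "b \<in> {1..5}"
  shows "pent (std_action g v) a b =
    of_int (sign g) * pent v (Hilbert_Choice.inv g a) (Hilbert_Choice.inv g b)"
  unfolding std_action_def
proof (rule pent_unpent[OF _ _ ab])
  fix a b
  show "of_int (sign g) * pent v (Hilbert_Choice.inv g a) (Hilbert_Choice.inv g b) =
    - (of_int (sign g) * pent v (Hilbert_Choice.inv g b) (Hilbert_Choice.inv g a))"
    using pent_antisym[of v "Hilbert_Choice.inv g a" "Hilbert_Choice.inv g b"] by simp
next
  fix a :: nat
  assume "a \<in> {1..5}"
  have ginv: "Hilbert_Choice.inv g permutes {1..5}"
    using g by (rule permutes_inv)
  have "(\<Sum>b\<in>{1..5}. pent v (Hilbert_Choice.inv g a) (Hilbert_Choice.inv g b)) =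
    (\<Sum>b\<in>{1..5}. pent v (Hilbert_Choice.inv g a) b)"
    using sum.permute[OF ginv, of "pent v (Hilbert_Choice.inv g a)"] by (simp add: comp_def)
  also have "\<dots> = 0"
    using \<open>a \<in> {1..5}\<close> ginv by (intro pent_row_sum) (simp only: permutes_in_image)
  finally show "(\<Sum>b\<in>{1..5}. of_int (sign g) *
      pent v (Hilbert_Choice.inv g a) (Hilbert_Choice.inv g b)) = 0"
    by (simp flip: sum_distrib_left)
qed

lemma unpent_cong:
  assumes "\<And>a b. a \<in> {1..5} \<Longrightarrow> b \<in> {1..5} \<Longrightarrow> M a b = N a b"
  shows "unpent M = unpent N"
  using assms by (simp add: vec_idx_eq_iff unpent_def)

lemma unpent_scale: "unpent (\<lambda>a b. c * M a b) = c *s unpent M"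
  by (simp add: vec_idx_eq_iff unpent_def algebra_simps diff_divide_distrib add_divide_distrib)

lemma std_action_mult:
  assumes g: "g permutes {1..5}" and h: "h permutes {1..5}"
  shows "std_action (g \<circ> h) v = std_action g (std_action h v)"
proof -
  have "permutation g" "permutation h"
    using g h by (auto simp: permutation_permutes)
  moreover have "Hilbert_Choice.inv (g \<circ> h) = Hilbert_Choice.inv h \<circ> Hilbert_Choice.inv g"
    using permutes_bij[OF g] permutes_bij[OF h] by (rule o_inv_distrib)
  moreover have "Hilbert_Choice.inv g a \<in> {1..5}" if "a \<in> {1..5}" for a
    using that permutes_in_image[OF permutes_inv[OF g]] by simp
  ultimately show ?thesis
    unfolding std_action_def[of "g \<circ> h"] std_action_def[of g]
    by (intro unpent_cong) (simp only: sign_compose pent_std_action[OF h] o_apply of_int_mult mult.assoc)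
qed

lemma std_action_id: "std_action id v = v"
  by (simp add: std_action_def unpent_pent)

lemma std_action_bij:
  assumes "g permutes {1..5}"
  shows "bij (std_action g)"
proof (rule o_bij)
  note inv = permutes_inv[OF assms]
  show "std_action (Hilbert_Choice.inv g) \<circ> std_action g = id"
    by (rule ext) (simp only: o_apply id_apply std_action_mult[OF inv assms, symmetric]
        permutes_inv_o[OF assms] std_action_id)
  show "std_action g \<circ> std_action (Hilbert_Choice.inv g) = id"
    by (rule ext) (simp only: o_apply id_apply std_action_mult[OF assms inv, symmetric]
        permutes_inv_o[OF assms] std_action_id)
qed

lemma std_action_group_action: "group_action (sym_group 5) UNIV std_action"
  unfolding group_action_def group_hom_def group_hom_axioms_def
proof (intro conjI sym_group_is_group group_BijGroup homI)
  fix g assume "g \<in> carrier (sym_group 5)"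
  then show "std_action g \<in> carrier (BijGroup UNIV)"
    by (simp add: sym_group_carrier BijGroup_def Bij_def std_action_bij)
next
  fix g h assume "g \<in> carrier (sym_group 5)" "h \<in> carrier (sym_group 5)"
  then show "std_action (g \<otimes>\<^bsub>sym_group 5\<^esub> h) = std_action g \<otimes>\<^bsub>BijGroup UNIV\<^esub> std_action h"
    by (simp add: sym_group_carrier sym_group_mult BijGroup_def Bij_def std_action_bij
        compose_def fun_eq_iff std_action_mult)
qed

lemma pent_upper_linear:
  "pent_upper (v + w) a b = pent_upper v a b + pent_upper w a b"
  "pent_upper (c *s v) a b = c * pent_upper v a b"
  by (simp_all add: pent_upper_def algebra_simps)

lemma std_action_linear: "Vector_Spaces.linear (*s) (*s) (std_action g)"
proof -
  have "std_action g (v + w) = std_action g v + std_action g w"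
    and "std_action g (c *s v) = c *s std_action g v" for v w c
    by (simp_all add: vec_idx_eq_iff std_action_def unpent_def pent_def pent_upper_linear field_simps)
  then show ?thesis
    by unfold_locales (simp_all add: vec.scale_right_distrib vec.scale_left_distrib)
qed

lemma eta_simps:
  "eta 1 2 3 = 1" "eta 2 3 1 = 1" "eta 3 1 2 = 1"
  "eta 2 1 3 = - 1" "eta 1 3 2 = - 1" "eta 3 2 1 = - 1"
proof -
  let ?t = "Transposition.transpose :: nat \<Rightarrow> nat \<Rightarrow> nat \<Rightarrow> nat"
  have "id(1 := 1, 2 := 2, 3 := 3) = (id :: nat \<Rightarrow> nat)"
    and "id(1 := 2, 2 := 3, 3 := 1) = ?t 1 2 \<circ> ?t 2 3"
    and "id(1 := 3, 2 := 1, 3 := 2) = ?t 2 3 \<circ> ?t 1 2"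
    and "id(1 := 2, 2 := 1, 3 := 3) = ?t 1 2"
    and "id(1 := 1, 2 := 3, 3 := 2) = ?t 2 3"
    and "id(1 := 3, 2 := 2, 3 := 1) = ?t 1 3"
    by (auto simp: fun_eq_iff Transposition.transpose_def)
  then show "eta 1 2 3 = 1" "eta 2 3 1 = 1" "eta 3 1 2 = 1"
    "eta 2 1 3 = - 1" "eta 1 3 2 = - 1" "eta 3 2 1 = - 1"
    by (simp_all only: eta_def sign_id sign_compose permutation_swap_id sign_swap_id) simp_all
qed

lemma s_vec_simps:
  "s_vec 1 2 = axis I12 1" "s_vec 1 3 = axis I13 1" "s_vec 2 1 = axis I21 1"
  "s_vec 2 3 = axis I23 1" "s_vec 3 1 = axis I31 1" "s_vec 3 2 = axis I32 1"
  by (simp_all add: s_vec_def ix_def)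

lemma sigma_vec_simps:
  "sigma_vec 1 2 = s_vec 1 3 - s_vec 3 1 - s_vec 2 3"
  "sigma_vec 2 3 = s_vec 2 1 - s_vec 1 2 - s_vec 3 1"
  "sigma_vec 3 1 = s_vec 3 2 - s_vec 2 3 - s_vec 1 2"
  "sigma_vec 2 1 = s_vec 1 3 + s_vec 3 2 - s_vec 2 3"
  "sigma_vec 1 3 = s_vec 2 1 + s_vec 3 2 - s_vec 1 2"
  "sigma_vec 3 2 = s_vec 1 3 + s_vec 2 1 - s_vec 3 1"
proof -
  have "third 1 2 = 3" "third 2 3 = 1" "third 3 1 = 2" "third 2 1 = 3" "third 1 3 = 2" "third 3 2 = 1"
    by (simp_all add: third_def)
  then show
    "sigma_vec 1 2 = s_vec 1 3 - s_vec 3 1 - s_vec 2 3"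
    "sigma_vec 2 3 = s_vec 2 1 - s_vec 1 2 - s_vec 3 1"
    "sigma_vec 3 1 = s_vec 3 2 - s_vec 2 3 - s_vec 1 2"
    "sigma_vec 2 1 = s_vec 1 3 + s_vec 3 2 - s_vec 2 3"
    "sigma_vec 1 3 = s_vec 2 1 + s_vec 3 2 - s_vec 1 2"
    "sigma_vec 3 2 = s_vec 1 3 + s_vec 2 1 - s_vec 3 1"
    by (simp_all add: sigma_vec_def vec_eq_iff eta_simps del: One_nat_def)
qed

lemma axis_idx: "axis I 1 $ J = (if I = J then 1 else 0 :: complex)"
  by (simp add: axis_def)

lemma set_eq_123_iff:
  "{i, j, k} = {1, 2, 3 :: nat} \<longleftrightarrow>
     (i, j, k) \<in> {(1,2,3), (1,3,2), (2,1,3), (2,3,1), (3,1,2), (3,2,1)}"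
  (is "?L \<longleftrightarrow> ?R")
proof
  assume L: ?L
  have "1 \<in> {i, j, k}" "2 \<in> {i, j, k}" "3 \<in> {i, j, k}"
    unfolding L by simp_all
  then show ?R
    by (elim insertE emptyE) simp_all
qed auto

lemma std_action_S3:
  assumes \<tau>: "\<tau> permutes {1..3}" and "i \<in> {1..3}" "j \<in> {1..3}" "i \<noteq> j"
  shows "std_action \<tau> (s_vec i j) = of_int (sign \<tau>) *s s_vec (\<tau> i) (\<tau> j)"
proof -
  have fix45: "Hilbert_Choice.inv \<tau> 4 = 4" "Hilbert_Choice.inv \<tau> 5 = 5"
    using permutes_not_in[OF permutes_inv[OF \<tau>]] by simp_all
  have "\<tau> ` {1..3} = {1..3}"
    using \<tau> by (rule permutes_image)
  then have "{\<tau> 1, \<tau> 2, \<tau> 3} = {1, 2, 3}"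
    unfolding atLeastAtMost_1_3 by simp
  then have cases:
    "(\<tau> 1, \<tau> 2, \<tau> 3) \<in> {(1,2,3), (1,3,2), (2,1,3), (2,3,1), (3,1,2), (3,2,1)}"
    by (simp only: set_eq_123_iff)
  have inv: "Hilbert_Choice.inv \<tau> (\<tau> 1) = 1" "Hilbert_Choice.inv \<tau> (\<tau> 2) = 2"
    "Hilbert_Choice.inv \<tau> (\<tau> 3) = 3"
    using permutes_inverses(2)[OF \<tau>] by blast+
  have ij: "(i = 1 \<and> j = 2) \<or> (i = 1 \<and> j = 3) \<or> (i = 2 \<and> j = 1) \<or>
      (i = 2 \<and> j = 3) \<or> (i = 3 \<and> j = 1) \<or> (i = 3 \<and> j = 2)"
    using assms(2-4) unfolding atLeastAtMost_1_3
    by (elim insertE emptyE) (simp_all del: One_nat_def)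
  have "unpent (\<lambda>a b. pent (s_vec i j) (Hilbert_Choice.inv \<tau> a) (Hilbert_Choice.inv \<tau> b)) =
      s_vec (\<tau> i) (\<tau> j)"
    using cases ij inv fix45
    by (elim insertE emptyE disjE conjE) (simp_all add: vec_idx_eq_iff unpent_def pent_simps
        s_vec_simps axis_idx del: One_nat_def)
  then show ?thesis
    by (simp only: std_action_def unpent_scale)
qed

lemma S5_action_exists: "\<exists>\<rho>. S5_action \<rho>"
proof
  have "std_action (Transposition.transpose 4 5) (s_vec i j) = s_vec i k"
    if "{i, j, k} = {1, 2, 3}" for i j k
    using that unfolding set_eq_123_iff
    by (auto simp: vec_idx_eq_iff std_action_def unpent_def pent_simps s_vec_simps axis_idx
        sign_swap_id Transposition.transpose_def simp del: One_nat_def)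
  then show "S5_action std_action"
    unfolding S5_action_def
    by (simp add: std_action_group_action std_action_linear std_action_S3 del: One_nat_def)
       (simp add: vec_idx_eq_iff std_action_def unpent_def pent_simps s_vec_simps
        sigma_vec_simps axis_idx sign_swap_id Transposition.transpose_def del: One_nat_def)
qed

end

theory Submission
  imports Defs
begin

text \<open>
  Equivariance: every transposition permutes the \<open>Q\<^sub>I\<close> up to the common sign \<open>-1\<close>, because it
  permutes the lines spanned by the twelve vectors \<open>s\<^sub>I\<close>, \<open>\<sigma>\<^sub>I\<close>, and it permutes the entries of \<open>A\<close>
  in the same way up to \<open>-1\<close>.

  Ideal: the Pfaffians span the same space as five quadrics which, in suitable coordinates
  \<open>c, y\<^sub>0, \<dots>, y\<^sub>4\<close> on \<open>V\<close>, are the relations \<open>y\<^sub>i y\<^sub>i\<^sub>+\<^sub>2 = c\<^sup>2 + c y\<^sub>i\<^sub>+\<^sub>1\<close> of the cluster algebra of type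
  \<open>A\<^sub>2\<close>.  Modulo these, a form is a combination of monomials in pairs of adjacent variables
  \<open>y\<^sub>i, y\<^sub>i\<^sub>+\<^sub>1\<close> plus a multiple of \<open>c\<close>.  If it vanishes on the surface, it vanishes on the pentagon of
  lines cut out by \<open>c = 0\<close>, where the adjacent monomials are linearly independent; hence it is a
  multiple of \<open>c\<close>, and induction on the degree applies to the quotient.
\<close>

section \<open>Linear extension and evaluation\<close>

lemma poly_mapping_additive_induct:
  fixes p :: "'a \<Rightarrow>\<^sub>0 'b::comm_monoid_add"
  assumes single: "\<And>m c. P (Poly_Mapping.single m c)"
    and add: "\<And>p q. P p \<Longrightarrow> P q \<Longrightarrow> P (p + q)"
  shows "P p"
proof (induction p rule: update_induct)
  case const
  show ?case using single[of _ 0] by simp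
next
  case (update p m c)
  have "Poly_Mapping.update m c p = p + Poly_Mapping.single m c"
    using update(1)
    by (intro poly_mapping_eqI) (auto simp: lookup_update lookup_add lookup_single in_keys_iff when_def)
  then show ?case using add[OF update(3) single] by simp
qed

lemma sum_keys_single:
  assumes "f m 0 = 0"
  shows "(\<Sum>k\<in>Poly_Mapping.keys (Poly_Mapping.single m c).
    f k (Poly_Mapping.lookup (Poly_Mapping.single m c) k)) = f m c"
  using assms by simp

text \<open>Common generalisation of \<^const>\<open>peval\<close> and \<^const>\<open>sym_map\<close>.\<close>

definition eval_in :: "(complex \<Rightarrow> 'a::comm_ring_1) \<Rightarrow> (idx \<Rightarrow> 'a) \<Rightarrow> symV \<Rightarrow> 'a" where
  "eval_in h w p = (\<Sum>m\<in>Poly_Mapping.keys p.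
     h (Poly_Mapping.lookup p m) * (\<Prod>I\<in>UNIV. w I ^ Poly_Mapping.lookup m I))"

text \<open>The map \<open>h\<close> is the structure map of the target algebra: the identity of the
  complex numbers for \<open>peval\<close>, and \<open>const\<close> for \<open>sym_map\<close>.
  Both inherit their homomorphism laws from here.\<close>

locale coeff_hom =
  fixes h :: "complex \<Rightarrow> 'a::comm_ring_1"
  assumes hom_add: "h (a + b) = h a + h b"
    and hom_mult: "h (a * b) = h a * h b"
    and hom_one: "h 1 = 1"
begin

lemma hom_zero: "h 0 = 0"
  using hom_add[of 0 0] by simp

lemma eval_single:
  "eval_in h w (Poly_Mapping.single m c) = h c * (\<Prod>I\<in>UNIV. w I ^ Poly_Mapping.lookup m I)"
  unfolding eval_in_def by (rule sum_keys_single) (simp add: hom_zero)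

lemma eval_zero: "eval_in h w 0 = 0"
  by (simp add: eval_in_def)

lemma eval_add: "eval_in h w (p + q) = eval_in h w p + eval_in h w q"
  unfolding eval_in_def
  by (rule setsum_keys_plus_distrib) (simp_all add: hom_zero hom_add distrib_right)

lemma eval_uminus: "eval_in h w (- p) = - eval_in h w p"
proof -
  have "eval_in h w (- p) + eval_in h w p = 0"
    using eval_add[of w "- p" p] by (simp add: eval_zero)
  then show ?thesis by (simp add: eq_neg_iff_add_eq_0)
qed

lemma eval_diff: "eval_in h w (p - q) = eval_in h w p - eval_in h w q"
  using eval_add[of w p "- q"] by (simp add: eval_uminus)

lemma eval_sum: "eval_in h w (sum f S) = (\<Sum>x\<in>S. eval_in h w (f x))"
  by (induction S rule: infinite_finite_induct) (simp_all add: eval_zero eval_add)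

lemma eval_mult_single:
  "eval_in h w (Poly_Mapping.single m c * q) = eval_in h w (Poly_Mapping.single m c) * eval_in h w q"
proof (induction q rule: poly_mapping_additive_induct)
  case (1 k d)
  show ?case
    by (simp add: eval_single mult_single hom_mult lookup_add power_add prod.distrib algebra_simps)
next
  case (2 p q)
  then show ?case by (simp add: eval_add distrib_left)
qed

lemma eval_mult: "eval_in h w (p * q) = eval_in h w p * eval_in h w q"
proof (induction p rule: poly_mapping_additive_induct)
  case (1 m c)
  show ?case by (rule eval_mult_single)
next
  case (2 p q)
  then show ?case by (simp add: eval_add distrib_right)
qed

lemma eval_const: "eval_in h w (const c) = h c"
  by (simp add: const_def eval_single)

lemma eval_one: "eval_in h w 1 = 1"
  using eval_const[of w 1] by (simp add: const_def hom_one)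

lemma eval_var: "eval_in h w (var I) = w I"
proof -
  have "(\<Prod>J\<in>UNIV. w J ^ Poly_Mapping.lookup (Poly_Mapping.single I 1) J) =
      (\<Prod>J\<in>UNIV. if J = I then w I else 1)"
    by (intro prod.cong) (auto simp: lookup_single)
  also have "\<dots> = w I"
    by simp
  finally show ?thesis by (simp add: var_def eval_single hom_one)
qed

lemma eval_power: "eval_in h w (p ^ n) = eval_in h w p ^ n"
  by (induction n) (simp_all add: eval_one eval_mult)

lemma eval_prod: "eval_in h w (prod f S) = (\<Prod>x\<in>S. eval_in h w (f x))"
  by (induction S rule: infinite_finite_induct) (simp_all add: eval_one eval_mult)

lemma eval_lin: "eval_in h w (lin v) = (\<Sum>I\<in>UNIV. h (v $ I) * w I)"
  by (simp add: lin_def eval_sum eval_mult eval_const eval_var)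

end

lemma const_add: "const (a + b) = const a + const b"
  by (simp add: const_def single_add)

lemma const_mult: "const (a * b) = const a * const b"
  by (simp add: const_def mult_single)

lemma const_one: "const 1 = 1"
  by (simp add: const_def)

lemma const_zero: "const 0 = 0"
  by (simp add: const_def)

lemma const_uminus: "const (- a) = - const a"
  by (simp add: const_def single_uminus)

lemma const_numeral: "const (numeral n) = numeral n"
  by (simp add: const_def)

lemma const_diff: "const (a - b) = const a - const b"
  by (simp add: const_def single_diff)

lemma coeff_hom_const: "coeff_hom const"
  by unfold_locales (simp_all add: const_add const_mult const_one)

lemma peval_eq_eval_in: "peval z = eval_in (\<lambda>c. c) z"
  by (rule ext) (simp add: peval_def eval_in_def)

lemma sym_map_eq_eval_in: "sym_map f = eval_in const (\<lambda>I. lin (f (axis I 1)))"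
  by (rule ext) (simp add: sym_map_def eval_in_def)

interpretation pev: coeff_hom "\<lambda>c. c :: complex"
  rewrites "\<And>z. eval_in (\<lambda>c. c) z = peval z"
  by unfold_locales (simp_all add: peval_eq_eval_in)

interpretation smap: coeff_hom const
  rewrites "\<And>f. eval_in const (\<lambda>I. lin (f (axis I 1))) = sym_map f"
  by (simp_all add: coeff_hom_const sym_map_eq_eval_in)

lemma lin_axis: "lin (axis I 1) = var I"
proof -
  have "lin (axis I 1) = (\<Sum>J\<in>UNIV. if J = I then var I else 0)"
    unfolding lin_def by (intro sum.cong) (auto simp: axis_def const_one const_zero)
  then show ?thesis by simp
qed

lemma lin_add: "lin (v + w) = lin v + lin w"
  by (simp add: lin_def const_add distrib_right sum.distrib)

lemma lin_scale: "lin (c *s v) = const c * lin v"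
  by (simp add: lin_def const_mult sum_distrib_left mult.assoc)

lemma lin_uminus: "lin (- v) = - lin v"
  by (simp add: lin_def const_uminus sum_negf)

lemma lin_diff: "lin (v - w) = lin v - lin w"
  by (simp add: lin_def const_diff left_diff_distrib sum_subtractf)

lemma lin_sum: "lin (sum f S) = (\<Sum>x\<in>S. lin (f x))"
  by (induction S rule: infinite_finite_induct) (simp_all add: lin_add, simp_all add: lin_def const_zero)

lemma vec_axis_expansion: "v = (\<Sum>I\<in>UNIV. (v $ I) *s axis I 1)" for v :: "complex ^ idx"
  by (simp add: vec_eq_iff axis_def if_distrib[where f = "\<lambda>x. _ * x"] cong: if_cong)

lemma sym_map_const: "sym_map f (const c) = const c"
  by (simp add: sym_map_eq_eval_in smap.eval_const)

lemma sym_map_var: "sym_map f (var I) = lin (f (axis I 1))"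
  by (simp add: sym_map_eq_eval_in smap.eval_var)

lemma sym_map_add: "sym_map f (p + q) = sym_map f p + sym_map f q"
  by (simp add: sym_map_eq_eval_in smap.eval_add)

lemma sym_map_mult: "sym_map f (p * q) = sym_map f p * sym_map f q"
  by (simp add: sym_map_eq_eval_in smap.eval_mult)

lemma sym_map_lin:
  assumes f: "Vector_Spaces.linear (*s) (*s) f"
  shows "sym_map f (lin v) = lin (f v)"
proof -
  interpret f: Vector_Spaces.linear "(*s)" "(*s)" f by (rule f)
  have "sym_map f (lin v) = (\<Sum>I\<in>UNIV. const (v $ I) * lin (f (axis I 1)))"
    by (simp add: sym_map_eq_eval_in smap.eval_lin)
  also have "\<dots> = lin (f (\<Sum>I\<in>UNIV. (v $ I) *s axis I 1))"
    by (simp add: f.sum f.scale lin_sum lin_scale)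
  finally show ?thesis by (simp flip: vec_axis_expansion)
qed

text \<open>Substituting linear forms and then evaluating is evaluating at the values of those
  forms. With target \<open>symV\<close> this gives functoriality of \<open>sym_map\<close>; with
  complex target it turns a change of coordinates on polynomials into one on points.\<close>

lemma eval_in_sym_map:
  assumes "coeff_hom h"
  shows "eval_in h w (sym_map f p) = eval_in h (\<lambda>I. eval_in h w (lin (f (axis I 1)))) p"
proof -
  interpret coeff_hom h by fact
  show ?thesis
    unfolding sym_map_def eval_sum eval_mult eval_const eval_prod eval_power
    by (simp add: eval_in_def)
qed

lemma sym_map_comp:
  assumes "Vector_Spaces.linear (*s) (*s) f"
  shows "sym_map f (sym_map g p) = sym_map (f \<circ> g) p"
  using eval_in_sym_map[OF coeff_hom_const, of "\<lambda>I. lin (f (axis I 1))" g p]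
    sym_map_lin[OF assms]
  by (simp flip: sym_map_eq_eval_in) (simp add: sym_map_eq_eval_in)

lemma peval_sym_map:
  "peval z (sym_map f p) = peval (\<lambda>I. peval z (lin (f (axis I 1)))) p"
  using eval_in_sym_map[OF pev.coeff_hom_axioms, of z f p]
  by (simp flip: peval_eq_eval_in)

text \<open>Each monomial is the product of the powers of its variables, so both sides agree on
  monomials; additivity does the rest.\<close>

lemma eval_in_var_id: "eval_in const var p = p"
proof (induction p rule: poly_mapping_additive_induct)
  case (1 m c)
  have pw: "Poly_Mapping.single (Poly_Mapping.single I (1::nat)) (1::complex) ^ n =
      Poly_Mapping.single (Poly_Mapping.single I n) 1" for I :: idx and n
    by (induction n) (simp_all add: mult_single single_add[symmetric])
  have "(\<Prod>I\<in>S. Poly_Mapping.single (Poly_Mapping.single I (Poly_Mapping.lookup m I)) (1::complex)) =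
      Poly_Mapping.single (\<Sum>I\<in>S. Poly_Mapping.single I (Poly_Mapping.lookup m I)) 1"
    for S :: "idx set"
    by (induction S rule: infinite_finite_induct) (simp_all add: mult_single)
  moreover have "(\<Sum>I\<in>UNIV. Poly_Mapping.single I (Poly_Mapping.lookup m I)) = m"
    by (rule poly_mapping_eqI) (simp add: lookup_sum lookup_single when_def)
  ultimately show ?case
    unfolding smap.eval_single unfolding var_def pw const_def by (simp add: mult_single)
next
  case (2 p q)
  then show ?case by (simp add: smap.eval_add)
qed

lemma sym_map_id: "sym_map id p = p"
  by (simp add: sym_map_eq_eval_in lin_axis eval_in_var_id)


section \<open>Tensor products\<close>

text \<open>Names the scalar multiplication that \<open>tensor_map\<close> spells out with
  \<open>Poly_Mapping.map\<close>, so that linearity can be stated uniformly for all the coefficient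
  spaces.\<close>

definition scale :: "complex \<Rightarrow> ('a \<Rightarrow>\<^sub>0 complex) \<Rightarrow> ('a \<Rightarrow>\<^sub>0 complex)" where
  "scale c = Poly_Mapping.map ((*) c)"

lemma lookup_scale: "Poly_Mapping.lookup (scale c p) k = c * Poly_Mapping.lookup p k"
  by (simp add: scale_def Poly_Mapping.map.rep_eq when_def)

lemma scale_single: "scale c (Poly_Mapping.single m d) = Poly_Mapping.single m (c * d)"
  by (simp add: scale_def)

lemma scale_add: "scale c (p + q) = scale c p + scale c q"
  by (intro poly_mapping_eqI) (simp add: lookup_scale lookup_add distrib_left)

lemma scale_add_left: "scale (a + b) p = scale a p + scale b p"
  by (intro poly_mapping_eqI) (simp add: lookup_scale lookup_add distrib_right)

lemma scale_diff: "scale c (p - q) = scale c p - scale c q"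
  by (intro poly_mapping_eqI) (simp add: lookup_scale lookup_minus right_diff_distrib)

lemma scale_scale: "scale a (scale b p) = scale (a * b) p"
  by (intro poly_mapping_eqI) (simp add: lookup_scale mult.assoc)

lemma scale_one: "scale 1 p = p"
  by (intro poly_mapping_eqI) (simp add: lookup_scale)

lemma scale_zero_left: "scale 0 p = 0"
  by (intro poly_mapping_eqI) (simp add: lookup_scale)

lemma scale_zero_right: "scale c 0 = 0"
  by (intro poly_mapping_eqI) (simp add: lookup_scale)

lemma const_mult_eq_scale: "const c * p = scale c p"
  by (simp add: const_def scale_def mult_map_scale_conv_mult)

definition pm_linear :: "(('a \<Rightarrow>\<^sub>0 complex) \<Rightarrow> ('b \<Rightarrow>\<^sub>0 complex)) \<Rightarrow> bool" where
  "pm_linear F \<longleftrightarrow> (\<forall>p q. F (p + q) = F p + F q) \<and> (\<forall>c p. F (scale c p) = scale c (F p))"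

lemma pm_linearD:
  assumes "pm_linear F"
  shows "F (p + q) = F p + F q" "F (scale c p) = scale c (F p)" "F (p - q) = F p - F q"
    "F (sum f S) = (\<Sum>x\<in>S. F (f x))"
proof -
  show add: "F (p + q) = F p + F q" for p q
    using assms by (simp add: pm_linear_def)
  show "F (scale c p) = scale c (F p)"
    using assms by (simp add: pm_linear_def)
  show "F (p - q) = F p - F q"
    using add[of "p - q" q] by simp
  have "F 0 = 0"
    using add[of 0 0] by simp
  then show "F (sum f S) = (\<Sum>x\<in>S. F (f x))"
    by (induction S rule: infinite_finite_induct) (simp_all add: add)
qed

lemma pm_linear_eqI:
  assumes "pm_linear F" "pm_linear G"
    and "\<And>m. F (Poly_Mapping.single m 1) = G (Poly_Mapping.single m 1)"
  shows "F p = G p"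
proof (induction p rule: poly_mapping_additive_induct)
  case (1 m c)
  have "Poly_Mapping.single m c = scale c (Poly_Mapping.single m 1)"
    by (simp add: scale_single)
  then show ?case
    by (simp add: pm_linearD(2)[OF assms(1)] pm_linearD(2)[OF assms(2)] assms(3))
next
  case (2 p q)
  then show ?case
    by (simp add: pm_linearD(1)[OF assms(1)] pm_linearD(1)[OF assms(2)])
qed

text \<open>All bilinearity laws of the tensor product are read off from this coefficient formula.
  Indices outside the supports cause no trouble because the coefficients there are 0.\<close>

lemma lookup_tensor:
  "Poly_Mapping.lookup (u \<otimes>\<^sub>t v) (a, b) = Poly_Mapping.lookup u a * Poly_Mapping.lookup v b"
proof -
  have inner: "(\<Sum>y\<in>Poly_Mapping.keys v.
      (Poly_Mapping.lookup u x * Poly_Mapping.lookup v y when (x, y) = (a, b))) =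
    (Poly_Mapping.lookup u x * Poly_Mapping.lookup v b when x = a)" for x
  proof -
    have "(\<Sum>y\<in>Poly_Mapping.keys v.
        (Poly_Mapping.lookup u x * Poly_Mapping.lookup v y when (x, y) = (a, b))) =
      (\<Sum>y\<in>Poly_Mapping.keys v. if y = b then
         (Poly_Mapping.lookup u x * Poly_Mapping.lookup v b when x = a) else 0)"
      by (intro sum.cong) (auto simp: when_def)
    then show ?thesis
      by (auto simp: in_keys_iff when_def)
  qed
  have "Poly_Mapping.lookup (u \<otimes>\<^sub>t v) (a, b) = (\<Sum>x\<in>Poly_Mapping.keys u.
      (Poly_Mapping.lookup u x * Poly_Mapping.lookup v b when x = a))"
    unfolding tensor_def lookup_sum lookup_single inner ..
  also have "\<dots> = (\<Sum>x\<in>Poly_Mapping.keys u. if x = a then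
      Poly_Mapping.lookup u a * Poly_Mapping.lookup v b else 0)"
    by (intro sum.cong) (auto simp: when_def)
  also have "\<dots> = Poly_Mapping.lookup u a * Poly_Mapping.lookup v b"
    by (auto simp: in_keys_iff)
  finally show ?thesis .
qed

lemma tensor_eqI:
  "(\<And>a b. Poly_Mapping.lookup p (a, b) = Poly_Mapping.lookup q (a, b)) \<Longrightarrow> p = q"
  by (rule poly_mapping_eqI) auto

lemma tensor_add_left: "(u + u') \<otimes>\<^sub>t v = u \<otimes>\<^sub>t v + u' \<otimes>\<^sub>t v"
  by (rule tensor_eqI) (simp add: lookup_tensor lookup_add distrib_right)

lemma tensor_add_right: "u \<otimes>\<^sub>t (v + v') = u \<otimes>\<^sub>t v + u \<otimes>\<^sub>t v'"
  by (rule tensor_eqI) (simp add: lookup_tensor lookup_add distrib_left)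

lemma tensor_scale_left: "scale c u \<otimes>\<^sub>t v = scale c (u \<otimes>\<^sub>t v)"
  by (rule tensor_eqI) (simp add: lookup_tensor lookup_scale)

lemma tensor_scale_right: "u \<otimes>\<^sub>t scale c v = scale c (u \<otimes>\<^sub>t v)"
  by (rule tensor_eqI) (simp add: lookup_tensor lookup_scale)

lemma tensor_single:
  "Poly_Mapping.single a c \<otimes>\<^sub>t Poly_Mapping.single b d = Poly_Mapping.single (a, b) (c * d)"
  by (rule tensor_eqI) (simp add: lookup_tensor lookup_single when_def)

lemma wedge_scale: "scale c u \<and>\<^sub>t scale d v = scale (c * d) (u \<and>\<^sub>t v)"
  by (simp add: wedge_def tensor_scale_left tensor_scale_right scale_scale scale_diff mult.commute)

lemma tensor_map_single:
  "tensor_map F G (Poly_Mapping.single (a, b) 1) =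
    F (Poly_Mapping.single a 1) \<otimes>\<^sub>t G (Poly_Mapping.single b 1)"
  by (simp add: tensor_map_def scale_one flip: scale_def)

lemma pm_linear_tensor_map: "pm_linear (tensor_map F G)"
proof -
  define f where "f k c = (case k of (a, b) \<Rightarrow>
    scale c (F (Poly_Mapping.single a 1) \<otimes>\<^sub>t G (Poly_Mapping.single b 1)))" for k c
  have eq: "tensor_map F G p = (\<Sum>k\<in>Poly_Mapping.keys p. f k (Poly_Mapping.lookup p k))" for p
    unfolding tensor_map_def f_def scale_def by (intro sum.cong) auto
  have f0: "f k 0 = 0" and f_add: "f k (c + d) = f k c + f k d"
    and f_scale: "f k (c * d) = scale c (f k d)" for k c d
    by (auto simp: f_def scale_zero_left scale_add_left scale_scale split: prod.split)
  have scale_sum: "scale c (sum h S) = (\<Sum>x\<in>S. scale c (h x))" for c S and h :: "_ \<Rightarrow> _ \<Rightarrow>\<^sub>0 complex"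
    by (induction S rule: infinite_finite_induct) (simp_all add: scale_add scale_zero_right)
  \<comment> \<open>The scalar 0 is treated apart because it shrinks the support over which the
    defining sum runs.\<close>
  have "tensor_map F G (scale c p) = scale c (tensor_map F G p)" for c p
  proof (cases "c = 0")
    case True
    then show ?thesis by (simp add: scale_zero_left eq)
  next
    case False
    then have "Poly_Mapping.keys (scale c p) = Poly_Mapping.keys p"
      by (auto simp: in_keys_iff lookup_scale)
    then show ?thesis
      by (simp add: eq lookup_scale f_scale scale_sum)
  qed
  moreover have "tensor_map F G (p + q) = tensor_map F G p + tensor_map F G q" for p q
    unfolding eq by (rule setsum_keys_plus_distrib) (simp_all add: f0 f_add)
  ultimately show ?thesis by (simp add: pm_linear_def)
qed

text \<open>Both sides are linear in \<open>u\<close> and in \<open>v\<close>, so it suffices to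
  compare them on pairs of basis vectors, where the definition of \<open>tensor_map\<close> applies
  directly.\<close>

lemma tensor_map_tensor:
  assumes F: "pm_linear F" and G: "pm_linear G"
  shows "tensor_map F G (u \<otimes>\<^sub>t v) = F u \<otimes>\<^sub>t G v"
proof -
  note T = pm_linearD[OF pm_linear_tensor_map[of F G]]
  note lin = pm_linearD[OF F] pm_linearD[OF G] T
    tensor_add_left tensor_add_right tensor_scale_left tensor_scale_right
  show ?thesis
  proof (rule pm_linear_eqI[where p = u])
    show "pm_linear (\<lambda>u. tensor_map F G (u \<otimes>\<^sub>t v))" "pm_linear (\<lambda>u. F u \<otimes>\<^sub>t G v)"
      by (simp_all add: pm_linear_def lin)
  next
    fix m
    show "tensor_map F G (Poly_Mapping.single m 1 \<otimes>\<^sub>t v) = F (Poly_Mapping.single m 1) \<otimes>\<^sub>t G v"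
    proof (rule pm_linear_eqI[where p = v])
      show "pm_linear (\<lambda>v. tensor_map F G (Poly_Mapping.single m 1 \<otimes>\<^sub>t v))"
        "pm_linear (\<lambda>v. F (Poly_Mapping.single m 1) \<otimes>\<^sub>t G v)"
        by (simp_all add: pm_linear_def lin)
    qed (simp add: tensor_single tensor_map_single)
  qed
qed

lemma tensor_map_wedge:
  assumes "pm_linear F"
  shows "tensor_map F F (u \<and>\<^sub>t v) = F u \<and>\<^sub>t F v"
  by (simp add: wedge_def pm_linearD[OF pm_linear_tensor_map] tensor_map_tensor assms)


section \<open>Equivariance\<close>

lemma pm_linear_sym_map: "pm_linear (sym_map f)"
  by (simp add: pm_linear_def sym_map_add sym_map_mult sym_map_const flip: const_mult_eq_scale)

text \<open>The entries of the matrix as elements of \<open>V\<close> itself, before passing to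
  \<open>symV\<close>, so that the representation can be applied to them.\<close>

definition A_vec :: "idx \<Rightarrow> idx \<Rightarrow> complex ^ idx" where
  "A_vec I J = A_upper I J - A_upper J I"

text \<open>Each element of the group permutes the \<open>Q\<^sub>I\<close> up to one common sign \<open>e\<close>, which cancels in
  \<open>Q\<^sub>I \<and> Q\<^sub>J\<close>.\<close>

definition permutes_A ::
  "((nat \<Rightarrow> nat) \<Rightarrow> complex ^ idx \<Rightarrow> complex ^ idx) \<Rightarrow> (nat \<Rightarrow> nat) \<Rightarrow> bool" where
  "permutes_A \<rho> g \<longleftrightarrow> (\<exists>\<pi> e. bij \<pi> \<and> e * e = 1 \<and>
     (\<forall>I. sym_map (\<rho> g) (Q_quad I) = const e * Q_quad (\<pi> I)) \<and>
     (\<forall>I J. \<rho> g (A_vec I J) = of_int (sign g) *s A_vec (\<pi> I) (\<pi> J)))"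

lemma of_int_sign_square: "of_int (sign g) * of_int (sign g) = (1 :: complex)"
  by (simp add: sign_def)

text \<open>All signs occur in pairs: \<open>e\<close> appears twice in the wedge of two quadrics,
  and \<open>sign g\<close> appears once from the twist and once from the entries of the matrix.
  What is left is a reindexing of the double sum by the bijection \<open>\<pi>\<close>.\<close>

lemma twisted_action_A_tensor:
  assumes lin: "Vector_Spaces.linear (*s) (*s) (\<rho> g)" and "permutes_A \<rho> g"
  shows "twisted_action \<rho> g A_tensor = A_tensor"
proof -
  obtain \<pi> e where \<pi>: "bij \<pi>" and e: "e * e = 1"
    and Q: "\<And>I. sym_map (\<rho> g) (Q_quad I) = scale e (Q_quad (\<pi> I))"
    and A: "\<And>I J. \<rho> g (A_vec I J) = of_int (sign g) *s A_vec (\<pi> I) (\<pi> J)"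
    using assms(2) unfolding permutes_A_def const_mult_eq_scale by blast
  define S where "S = sym_map (\<rho> g)"
  define G where "G u = const (of_int (sign g)) * S u" for u
  have S: "pm_linear S"
    unfolding S_def by (rule pm_linear_sym_map)
  have "pm_linear G"
    unfolding pm_linear_def G_def const_mult_eq_scale pm_linearD[OF S]
    by (simp add: scale_add scale_scale mult.commute)
  note lin_twist = pm_linearD[OF pm_linear_tensor_map] tensor_map_tensor[OF pm_linear_tensor_map this]
    tensor_map_wedge[OF S]
  have G_A: "G (A_mat I J) = A_mat (\<pi> I) (\<pi> J)" for I J
  proof -
    have "G (A_mat I J) = lin (of_int (sign g) *s (of_int (sign g) *s A_vec (\<pi> I) (\<pi> J)))"
      by (simp add: A_mat_def G_def S_def sym_map_lin[OF lin] lin_scale A vec.scale_scale const_mult mult.assoc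
          flip: A_vec_def)
    also have "\<dots> = lin (A_vec (\<pi> I) (\<pi> J))"
      by (simp add: vec.scale_scale of_int_sign_square del: of_int_mult)
    finally show ?thesis by (simp add: A_mat_def A_vec_def)
  qed
  have "twisted_action \<rho> g A_tensor =
      (\<Sum>I\<in>UNIV. \<Sum>J\<in>UNIV. (Q_quad (\<pi> I) \<and>\<^sub>t Q_quad (\<pi> J)) \<otimes>\<^sub>t A_mat (\<pi> I) (\<pi> J))"
    unfolding twisted_action_def A_tensor_def
    by (simp add: lin_twist G_A wedge_scale Q e scale_one flip: S_def G_def)
      (simp add: S_def Q wedge_scale e scale_one)
  also have "\<dots> = (\<Sum>I\<in>UNIV. \<Sum>J\<in>UNIV. (Q_quad (\<pi> I) \<and>\<^sub>t Q_quad J) \<otimes>\<^sub>t A_mat (\<pi> I) J)"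
    by (intro sum.cong refl sum.reindex_bij_betw[OF \<pi>])
  also have "\<dots> = A_tensor"
    unfolding A_tensor_def
    by (rule sum.reindex_bij_betw[OF \<pi>,
          of "\<lambda>I. \<Sum>J\<in>UNIV. (Q_quad I \<and>\<^sub>t Q_quad J) \<otimes>\<^sub>t A_mat I J"])
  finally show ?thesis .
qed

lemma S5_action_comp:
  assumes "S5_action \<rho>" "g permutes {1..5}" "h permutes {1..5}"
  shows "\<rho> (g \<circ> h) = \<rho> g \<circ> \<rho> h"
proof -
  interpret group_action "sym_group 5" UNIV \<rho>
    using assms(1) by (simp add: S5_action_def)
  show ?thesis
    using composition_rule[of _ g h] assms(2,3)
    by (auto simp: sym_group_carrier sym_group_mult)
qed

lemma S5_action_linear:
  assumes "S5_action \<rho>" "g permutes {1..5}"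
  shows "Vector_Spaces.linear (*s) (*s) (\<rho> g)"
  using assms by (simp add: S5_action_def sym_group_carrier)

text \<open>The bijections compose, the common signs multiply, and \<open>sign\<close> is
  multiplicative; hence the property has to be checked only on generators of the group.\<close>

lemma permutes_A_comp:
  assumes \<rho>: "S5_action \<rho>" and g: "g permutes {1..5}" and h: "h permutes {1..5}"
    and "permutes_A \<rho> g" "permutes_A \<rho> h"
  shows "permutes_A \<rho> (g \<circ> h)"
proof -
  obtain \<pi> e where 1: "bij \<pi>" "e * e = 1"
    "\<And>I. sym_map (\<rho> g) (Q_quad I) = const e * Q_quad (\<pi> I)"
    "\<And>I J. \<rho> g (A_vec I J) = of_int (sign g) *s A_vec (\<pi> I) (\<pi> J)"
    using assms(4) unfolding permutes_A_def by blast
  obtain \<pi>' e' where 2: "bij \<pi>'" "e' * e' = 1"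
    "\<And>I. sym_map (\<rho> h) (Q_quad I) = const e' * Q_quad (\<pi>' I)"
    "\<And>I J. \<rho> h (A_vec I J) = of_int (sign h) *s A_vec (\<pi>' I) (\<pi>' J)"
    using assms(5) unfolding permutes_A_def by blast
  note lin = S5_action_linear[OF \<rho> g]
  interpret \<rho>g: Vector_Spaces.linear "(*s)" "(*s)" "\<rho> g" by (rule lin)
  have "permutation g" "permutation h"
    using g h by (auto simp: permutation_permutes)
  then have sgn: "sign (g \<circ> h) = sign g * sign h"
    by (rule sign_compose)
  show ?thesis
    unfolding permutes_A_def
  proof (intro exI conjI allI)
    show "bij (\<pi> \<circ> \<pi>')"
      using 2(1) 1(1) by (rule bij_comp)
    show "(e * e') * (e * e') = 1"
      using 1(2) 2(2) by (metis mult.assoc mult.commute mult.right_neutral)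
    show "sym_map (\<rho> (g \<circ> h)) (Q_quad I) = const (e * e') * Q_quad ((\<pi> \<circ> \<pi>') I)" for I
      by (simp add: S5_action_comp[OF \<rho> g h] sym_map_comp[OF lin, symmetric] 1 2 sym_map_mult
          sym_map_const const_mult)
    show "\<rho> (g \<circ> h) (A_vec I J) = of_int (sign (g \<circ> h)) *s A_vec ((\<pi> \<circ> \<pi>') I) ((\<pi> \<circ> \<pi>') J)"
      for I J
      by (simp add: S5_action_comp[OF \<rho> g h] 1 2 \<rho>g.scale sgn mult.commute)
  qed
qed

lemma all_idx: "(\<forall>I. P I) \<longleftrightarrow> P I12 \<and> P I13 \<and> P I21 \<and> P I23 \<and> P I31 \<and> P I32"
  using idx.exhaust by metis


section \<open>The adjacent transpositions as generators\<close>

primrec s_idx :: "idx \<Rightarrow> complex ^ idx" where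
  "s_idx I12 = s_vec 1 2" | "s_idx I13 = s_vec 1 3" | "s_idx I21 = s_vec 2 1"
| "s_idx I23 = s_vec 2 3" | "s_idx I31 = s_vec 3 1" | "s_idx I32 = s_vec 3 2"

primrec sigma_idx :: "idx \<Rightarrow> complex ^ idx" where
  "sigma_idx I12 = sigma_vec 1 2" | "sigma_idx I13 = sigma_vec 1 3" | "sigma_idx I21 = sigma_vec 2 1"
| "sigma_idx I23 = sigma_vec 2 3" | "sigma_idx I31 = sigma_vec 3 1" | "sigma_idx I32 = sigma_vec 3 2"

lemma Q_quad_eq: "Q_quad I = lin (s_idx I) * lin (sigma_idx I)"
  by (cases I) (simp_all add: Q_quad_def)

text \<open>Turns the prescribed images of the basis vectors into coordinate formulas for the action
  of a generator, after which every claim about it is a finite check of coordinates.\<close>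

lemma linear_expansion:
  assumes "Vector_Spaces.linear (*s) (*s) f"
  shows "f v = v$I12 *s f (s_vec 1 2) + v$I13 *s f (s_vec 1 3) + v$I21 *s f (s_vec 2 1)
    + v$I23 *s f (s_vec 2 3) + v$I31 *s f (s_vec 3 1) + v$I32 *s f (s_vec 3 2)"
proof -
  interpret f: Vector_Spaces.linear "(*s)" "(*s)" f by fact
  have "v = v$I12 *s s_vec 1 2 + v$I13 *s s_vec 1 3 + v$I21 *s s_vec 2 1
    + v$I23 *s s_vec 2 3 + v$I31 *s s_vec 3 1 + v$I32 *s s_vec 3 2"
    unfolding vec_idx_eq_iff by (simp add: s_vec_simps axis_idx del: One_nat_def)
  then have "f v = f (v$I12 *s s_vec 1 2 + v$I13 *s s_vec 1 3 + v$I21 *s s_vec 2 1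
    + v$I23 *s s_vec 2 3 + v$I31 *s s_vec 3 1 + v$I32 *s s_vec 3 2)"
    by (rule arg_cong)
  then show ?thesis by (simp only: f.add f.scale)
qed

text \<open>A transposition may interchange the two factors of \<open>Q\<^sub>I\<close>.\<close>

lemma permutes_A_transpositionI:
  assumes \<rho>: "S5_action \<rho>" and ab: "a \<in> {1..5}" "b \<in> {1..5}" "a \<noteq> b"
    and g: "g = Transposition.transpose a b"
    and inv: "\<And>I. \<pi> (\<pi> I) = I"
    and Q: "\<And>I. (\<rho> g (s_idx I) = s_idx (\<pi> I) \<and> \<rho> g (sigma_idx I) = - sigma_idx (\<pi> I)) \<or>
      (\<rho> g (s_idx I) = - s_idx (\<pi> I) \<and> \<rho> g (sigma_idx I) = sigma_idx (\<pi> I)) \<or>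
      (\<rho> g (s_idx I) = sigma_idx (\<pi> I) \<and> \<rho> g (sigma_idx I) = - s_idx (\<pi> I)) \<or>
      (\<rho> g (s_idx I) = - sigma_idx (\<pi> I) \<and> \<rho> g (sigma_idx I) = s_idx (\<pi> I))"
    and A: "\<And>I J. \<rho> g (A_vec I J) = - A_vec (\<pi> I) (\<pi> J)"
  shows "permutes_A \<rho> g"
  unfolding permutes_A_def
proof (intro exI conjI allI)
  show "bij \<pi>"
    using inv by (rule involuntory_imp_bij)
  \<comment> \<open>In each alternative of \<open>Q\<close> exactly one of the two image factors
    carries a minus sign, so the common sign is -1.\<close>
  show "(- 1) * (- 1) = (1 :: complex)" by simp
  have "Vector_Spaces.linear (*s) (*s) (\<rho> g)"
    unfolding g using \<rho> permutes_swap_id[OF ab(1,2)] by (rule S5_action_linear)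
  then show "sym_map (\<rho> g) (Q_quad I) = const (- 1) * Q_quad (\<pi> I)" for I
    using Q[of I]
    by (auto simp: Q_quad_eq sym_map_mult sym_map_lin lin_uminus const_uminus const_one mult.commute)
  show "\<rho> g (A_vec I J) = of_int (sign g) *s A_vec (\<pi> I) (\<pi> J)" for I J
    using ab(3) by (simp add: A[unfolded g] g sign_swap_id)
qed

text \<open>This involution and the three after it record how the adjacent transpositions permute
  the quadrics up to sign. The first two relabel the indices 1, 2, 3; the last two are read off from
  the prescribed images, for instance \<open>I12\<close> is paired with \<open>I31\<close> in
  \<open>swap34\<close> because (3,4) sends \<open>s_vec 1 2\<close> to
  \<open>sigma_vec 3 1\<close>.\<close>

primrec swap12 :: "idx \<Rightarrow> idx" where
  "swap12 I12 = I21" | "swap12 I21 = I12" | "swap12 I13 = I23" | "swap12 I23 = I13"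
| "swap12 I31 = I32" | "swap12 I32 = I31"

primrec swap23 :: "idx \<Rightarrow> idx" where
  "swap23 I12 = I13" | "swap23 I13 = I12" | "swap23 I21 = I31" | "swap23 I31 = I21"
| "swap23 I23 = I32" | "swap23 I32 = I23"

primrec swap34 :: "idx \<Rightarrow> idx" where
  "swap34 I12 = I31" | "swap34 I31 = I12" | "swap34 I13 = I23" | "swap34 I23 = I13"
| "swap34 I21 = I32" | "swap34 I32 = I21"

primrec swap45 :: "idx \<Rightarrow> idx" where
  "swap45 I12 = I13" | "swap45 I13 = I12" | "swap45 I21 = I23" | "swap45 I23 = I21"
| "swap45 I31 = I32" | "swap45 I32 = I31"

lemmas idx_vec_simps = vec_idx_eq_iff s_vec_simps sigma_vec_simps axis_idx A_vec_def

lemma S5_action_transpose_S3: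
  assumes "S5_action \<rho>" "a \<in> {1..3}" "b \<in> {1..3}" "a \<noteq> b" "i \<in> {1..3}" "j \<in> {1..3}" "i \<noteq> j"
  shows "\<rho> (Transposition.transpose a b) (s_vec i j) =
    - s_vec (Transposition.transpose a b i) (Transposition.transpose a b j)"
proof -
  have "Transposition.transpose a b permutes {1..3}"
    using assms(2,3) by (rule permutes_swap_id)
  then have "\<rho> (Transposition.transpose a b) (s_vec i j) = of_int (sign (Transposition.transpose a b))
      *s s_vec (Transposition.transpose a b i) (Transposition.transpose a b j)"
    using assms(1,5-7) unfolding S5_action_def by blast
  then show ?thesis
    using assms(4) by (simp add: sign_swap_id)
qed

lemma permutes_A_12:
  assumes \<rho>: "S5_action \<rho>"
  shows "permutes_A \<rho> (Transposition.transpose 1 2)" (is "permutes_A _ ?g")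
proof (rule permutes_A_transpositionI[OF \<rho> _ _ _ refl])
  have lin: "Vector_Spaces.linear (*s) (*s) (\<rho> ?g)"
    by (rule S5_action_linear[OF \<rho> permutes_swap_id]) simp_all
  have "\<rho> ?g (s_vec 1 2) = - s_vec 2 1" "\<rho> ?g (s_vec 1 3) = - s_vec 2 3"
    "\<rho> ?g (s_vec 2 1) = - s_vec 1 2" "\<rho> ?g (s_vec 2 3) = - s_vec 1 3"
    "\<rho> ?g (s_vec 3 1) = - s_vec 3 2" "\<rho> ?g (s_vec 3 2) = - s_vec 3 1"
    using S5_action_transpose_S3[OF \<rho>, of 1 2 1 2] S5_action_transpose_S3[OF \<rho>, of 1 2 1 3]
      S5_action_transpose_S3[OF \<rho>, of 1 2 2 1] S5_action_transpose_S3[OF \<rho>, of 1 2 2 3]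
      S5_action_transpose_S3[OF \<rho>, of 1 2 3 1] S5_action_transpose_S3[OF \<rho>, of 1 2 3 2]
    by (simp_all add: Transposition.transpose_def del: One_nat_def)
  then have \<rho>_g:
    "\<rho> ?g v $ I12 = - v $ I21" "\<rho> ?g v $ I13 = - v $ I23"
    "\<rho> ?g v $ I21 = - v $ I12" "\<rho> ?g v $ I23 = - v $ I13"
    "\<rho> ?g v $ I31 = - v $ I32" "\<rho> ?g v $ I32 = - v $ I31" for v
    by (simp_all add: linear_expansion[OF lin, of v] s_vec_simps sigma_vec_simps axis_idx
        del: One_nat_def)
  show "\<rho> ?g (A_vec I J) = - A_vec (swap12 I) (swap12 J)" for I J
    by (cases I; cases J) (simp_all add: idx_vec_simps \<rho>_g del: One_nat_def)
  show "(\<rho> ?g (s_idx I) = s_idx (swap12 I) \<and> \<rho> ?g (sigma_idx I) = - sigma_idx (swap12 I)) \<or>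
      (\<rho> ?g (s_idx I) = - s_idx (swap12 I) \<and> \<rho> ?g (sigma_idx I) = sigma_idx (swap12 I)) \<or>
      (\<rho> ?g (s_idx I) = sigma_idx (swap12 I) \<and> \<rho> ?g (sigma_idx I) = - s_idx (swap12 I)) \<or>
      (\<rho> ?g (s_idx I) = - sigma_idx (swap12 I) \<and> \<rho> ?g (sigma_idx I) = s_idx (swap12 I))" for I
    by (cases I) (simp_all add: idx_vec_simps \<rho>_g del: One_nat_def)
  show "swap12 (swap12 I) = I" for I
    by (cases I) simp_all
qed simp_all

lemma permutes_A_23:
  assumes \<rho>: "S5_action \<rho>"
  shows "permutes_A \<rho> (Transposition.transpose 2 3)" (is "permutes_A _ ?g")
proof (rule permutes_A_transpositionI[OF \<rho> _ _ _ refl])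
  have lin: "Vector_Spaces.linear (*s) (*s) (\<rho> ?g)"
    by (rule S5_action_linear[OF \<rho> permutes_swap_id]) simp_all
  have "\<rho> ?g (s_vec 1 2) = - s_vec 1 3" "\<rho> ?g (s_vec 1 3) = - s_vec 1 2"
    "\<rho> ?g (s_vec 2 1) = - s_vec 3 1" "\<rho> ?g (s_vec 2 3) = - s_vec 3 2"
    "\<rho> ?g (s_vec 3 1) = - s_vec 2 1" "\<rho> ?g (s_vec 3 2) = - s_vec 2 3"
    using S5_action_transpose_S3[OF \<rho>, of 2 3 1 2] S5_action_transpose_S3[OF \<rho>, of 2 3 1 3]
      S5_action_transpose_S3[OF \<rho>, of 2 3 2 1] S5_action_transpose_S3[OF \<rho>, of 2 3 2 3]
      S5_action_transpose_S3[OF \<rho>, of 2 3 3 1] S5_action_transpose_S3[OF \<rho>, of 2 3 3 2]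
    by (simp_all add: Transposition.transpose_def del: One_nat_def)
  then have \<rho>_g:
    "\<rho> ?g v $ I12 = - v $ I13" "\<rho> ?g v $ I13 = - v $ I12"
    "\<rho> ?g v $ I21 = - v $ I31" "\<rho> ?g v $ I23 = - v $ I32"
    "\<rho> ?g v $ I31 = - v $ I21" "\<rho> ?g v $ I32 = - v $ I23" for v
    by (simp_all add: linear_expansion[OF lin, of v] s_vec_simps sigma_vec_simps axis_idx
        del: One_nat_def)
  show "\<rho> ?g (A_vec I J) = - A_vec (swap23 I) (swap23 J)" for I J
    by (cases I; cases J) (simp_all add: idx_vec_simps \<rho>_g del: One_nat_def)
  show "(\<rho> ?g (s_idx I) = s_idx (swap23 I) \<and> \<rho> ?g (sigma_idx I) = - sigma_idx (swap23 I)) \<or>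
      (\<rho> ?g (s_idx I) = - s_idx (swap23 I) \<and> \<rho> ?g (sigma_idx I) = sigma_idx (swap23 I)) \<or>
      (\<rho> ?g (s_idx I) = sigma_idx (swap23 I) \<and> \<rho> ?g (sigma_idx I) = - s_idx (swap23 I)) \<or>
      (\<rho> ?g (s_idx I) = - sigma_idx (swap23 I) \<and> \<rho> ?g (sigma_idx I) = s_idx (swap23 I))" for I
    by (cases I) (simp_all add: idx_vec_simps \<rho>_g del: One_nat_def)
  show "swap23 (swap23 I) = I" for I
    by (cases I) simp_all
qed simp_all

text \<open>Among the four generators this is the one that mixes the two kinds of factors:
  \<open>s_vec 1 3\<close> and \<open>s_vec 2 3\<close> are exchanged, while the other four basis
  vectors go to vectors \<open>sigma_vec\<close> up to sign.\<close>

lemma permutes_A_34: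
  assumes \<rho>: "S5_action \<rho>"
  shows "permutes_A \<rho> (Transposition.transpose 3 4)" (is "permutes_A _ ?g")
proof (rule permutes_A_transpositionI[OF \<rho> _ _ _ refl])
  have lin: "Vector_Spaces.linear (*s) (*s) (\<rho> ?g)"
    by (rule S5_action_linear[OF \<rho> permutes_swap_id]) simp_all
  have "\<rho> ?g (s_vec 1 2) = sigma_vec 3 1" "\<rho> ?g (s_vec 1 3) = s_vec 2 3"
    "\<rho> ?g (s_vec 2 1) = - sigma_vec 3 2" "\<rho> ?g (s_vec 2 3) = s_vec 1 3"
    "\<rho> ?g (s_vec 3 1) = - sigma_vec 1 2" "\<rho> ?g (s_vec 3 2) = sigma_vec 2 1"
    using \<rho> by (simp_all add: S5_action_def del: One_nat_def)
  then have \<rho>_g: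
    "\<rho> ?g v $ I12 = - v $ I12" "\<rho> ?g v $ I13 = - v $ I21 + v $ I23 - v $ I31 + v $ I32"
    "\<rho> ?g v $ I21 = - v $ I21" "\<rho> ?g v $ I23 = - v $ I12 + v $ I13 + v $ I31 - v $ I32"
    "\<rho> ?g v $ I31 = v $ I21 + v $ I31" "\<rho> ?g v $ I32 = v $ I12 + v $ I32" for v
    by (simp_all add: linear_expansion[OF lin, of v] s_vec_simps sigma_vec_simps axis_idx
        del: One_nat_def)
  show "\<rho> ?g (A_vec I J) = - A_vec (swap34 I) (swap34 J)" for I J
    by (cases I; cases J) (simp_all add: idx_vec_simps \<rho>_g del: One_nat_def)
  show "(\<rho> ?g (s_idx I) = s_idx (swap34 I) \<and> \<rho> ?g (sigma_idx I) = - sigma_idx (swap34 I)) \<or>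
      (\<rho> ?g (s_idx I) = - s_idx (swap34 I) \<and> \<rho> ?g (sigma_idx I) = sigma_idx (swap34 I)) \<or>
      (\<rho> ?g (s_idx I) = sigma_idx (swap34 I) \<and> \<rho> ?g (sigma_idx I) = - s_idx (swap34 I)) \<or>
      (\<rho> ?g (s_idx I) = - sigma_idx (swap34 I) \<and> \<rho> ?g (sigma_idx I) = s_idx (swap34 I))" for I
    by (cases I) (simp_all add: idx_vec_simps \<rho>_g del: One_nat_def)
  show "swap34 (swap34 I) = I" for I
    by (cases I) simp_all
qed simp_all

lemma permutes_A_45:
  assumes \<rho>: "S5_action \<rho>"
  shows "permutes_A \<rho> (Transposition.transpose 4 5)" (is "permutes_A _ ?g")
proof (rule permutes_A_transpositionI[OF \<rho> _ _ _ refl])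
  have lin: "Vector_Spaces.linear (*s) (*s) (\<rho> ?g)"
    by (rule S5_action_linear[OF \<rho> permutes_swap_id]) simp_all
  have "\<rho> ?g (s_vec 1 2) = s_vec 1 3" "\<rho> ?g (s_vec 1 3) = s_vec 1 2"
    "\<rho> ?g (s_vec 2 1) = s_vec 2 3" "\<rho> ?g (s_vec 2 3) = s_vec 2 1"
    "\<rho> ?g (s_vec 3 1) = s_vec 3 2" "\<rho> ?g (s_vec 3 2) = s_vec 3 1"
    using \<rho> by (simp_all add: S5_action_def set_eq_123_iff del: One_nat_def)
  then have \<rho>_g:
    "\<rho> ?g v $ I12 = v $ I13" "\<rho> ?g v $ I13 = v $ I12"
    "\<rho> ?g v $ I21 = v $ I23" "\<rho> ?g v $ I23 = v $ I21"
    "\<rho> ?g v $ I31 = v $ I32" "\<rho> ?g v $ I32 = v $ I31" for v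
    by (simp_all add: linear_expansion[OF lin, of v] s_vec_simps sigma_vec_simps axis_idx
        del: One_nat_def)
  show "\<rho> ?g (A_vec I J) = - A_vec (swap45 I) (swap45 J)" for I J
    by (cases I; cases J) (simp_all add: idx_vec_simps \<rho>_g del: One_nat_def)
  show "(\<rho> ?g (s_idx I) = s_idx (swap45 I) \<and> \<rho> ?g (sigma_idx I) = - sigma_idx (swap45 I)) \<or>
      (\<rho> ?g (s_idx I) = - s_idx (swap45 I) \<and> \<rho> ?g (sigma_idx I) = sigma_idx (swap45 I)) \<or>
      (\<rho> ?g (s_idx I) = sigma_idx (swap45 I) \<and> \<rho> ?g (sigma_idx I) = - s_idx (swap45 I)) \<or>
      (\<rho> ?g (s_idx I) = - sigma_idx (swap45 I) \<and> \<rho> ?g (sigma_idx I) = s_idx (swap45 I))" for I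
    by (cases I) (simp_all add: idx_vec_simps \<rho>_g del: One_nat_def)
  show "swap45 (swap45 I) = I" for I
    by (cases I) simp_all
qed simp_all

text \<open>Induction on \<open>b\<close> from adjacent transpositions: conjugating (a, b) by (b,
  b+1) gives (a, b+1).\<close>

lemma permutes_A_transpose:
  assumes \<rho>: "S5_action \<rho>" and "1 \<le> a" "a < b" "b \<le> 5"
  shows "permutes_A \<rho> (Transposition.transpose a b)"
  using \<open>a < b\<close> \<open>b \<le> 5\<close>
proof (induction b)
  case (Suc b)
  have adjacent: "permutes_A \<rho> (Transposition.transpose b (Suc b))"
  proof -
    have "b = 1 \<or> b = 2 \<or> b = 3 \<or> b = 4"
      using Suc.prems assms(2) by linarith
    then show ?thesis
      using permutes_A_12[OF \<rho>] permutes_A_23[OF \<rho>] permutes_A_34[OF \<rho>] permutes_A_45[OF \<rho>]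
      by (auto simp: numeral_eq_Suc)
  qed
  show ?case
  proof (cases "a = b")
    case False
    then have "a < b" using Suc.prems by simp
    let ?s = "Transposition.transpose b (Suc b)" and ?t = "Transposition.transpose a b"
    have perm: "?s permutes {1..5}" "?t permutes {1..5}"
      using \<open>a < b\<close> Suc.prems assms(2) by (auto intro!: permutes_swap_id)
    have eq: "Transposition.transpose a (Suc b) = ?s \<circ> (?t \<circ> ?s)"
      using \<open>a < b\<close> by (auto simp: fun_eq_iff Transposition.transpose_def)
    have "permutes_A \<rho> ?t"
      using Suc.IH \<open>a < b\<close> Suc.prems(2) by simp
    then show ?thesis
      unfolding eq by (intro permutes_A_comp[OF \<rho>] permutes_compose perm adjacent)
  qed (simp add: adjacent)
qed simp

text \<open>The identity is the square of a transposition.\<close>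

lemma permutes_A_id:
  assumes "S5_action \<rho>"
  shows "permutes_A \<rho> id"
  using permutes_A_comp[OF assms, of "Transposition.transpose 1 2" "Transposition.transpose 1 2"]
    permutes_A_12[OF assms]
  by (simp add: permutes_swap_id)

lemma permutes_A_permutation:
  assumes \<rho>: "S5_action \<rho>" and "g permutes {1..5}"
  shows "permutes_A \<rho> g"
  using assms(2) finite_atLeastAtMost
proof (induction rule: permutes_induct)
  case id
  show ?case by (rule permutes_A_id[OF \<rho>])
next
  case (swap a b p)
  have "permutes_A \<rho> (Transposition.transpose a b)"
  proof (cases "a < b")
    case True
    then show ?thesis using swap by (intro permutes_A_transpose[OF \<rho>]) auto
  next
    case False
    then have "permutes_A \<rho> (Transposition.transpose b a)"
      using swap by (intro permutes_A_transpose[OF \<rho>]) auto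
    then show ?thesis by (simp add: transpose_commute)
  qed
  then show ?case
    using swap by (intro permutes_A_comp[OF \<rho>] permutes_swap_id) auto
qed

lemma A_tensor_invariant:
  assumes "S5_action \<rho>" "g \<in> carrier (sym_group 5)"
  shows "twisted_action \<rho> g A_tensor = A_tensor"
  using assms by (intro twisted_action_A_tensor S5_action_linear permutes_A_permutation)
    (simp_all add: sym_group_carrier)


section \<open>Homogeneous polynomials and ideals\<close>

lemma peval_simps:
  "peval z 0 = 0" "peval z 1 = 1" "peval z (p + q) = peval z p + peval z q"
  "peval z (- p) = - peval z p" "peval z (p - q) = peval z p - peval z q"
  "peval z (p * q) = peval z p * peval z q" "peval z (p ^ n) = peval z p ^ n"
  "peval z (const c) = c" "peval z (var I) = z I" "peval z (lin v) = (\<Sum>I\<in>UNIV. v $ I * z I)"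
  "peval z (Poly_Mapping.single m c) = c * (\<Prod>I\<in>UNIV. z I ^ Poly_Mapping.lookup m I)"
  "peval z (sum f S) = (\<Sum>x\<in>S. peval z (f x))"
  by (simp_all add: pev.eval_zero pev.eval_one pev.eval_add pev.eval_uminus pev.eval_diff
      pev.eval_mult pev.eval_power pev.eval_const pev.eval_var pev.eval_lin pev.eval_single
      pev.eval_sum)

definition mdeg :: "(idx \<Rightarrow>\<^sub>0 nat) \<Rightarrow> nat" where
  "mdeg m = (\<Sum>I\<in>UNIV. Poly_Mapping.lookup m I)"

lemma homogeneous_iff: "homogeneous d p \<longleftrightarrow> (\<forall>m\<in>Poly_Mapping.keys p. mdeg m = d)"
  by (simp add: homogeneous_def mdeg_def)

lemma mdeg_add: "mdeg (m + m') = mdeg m + mdeg m'"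
  by (simp add: mdeg_def lookup_add sum.distrib)

lemma mdeg_single: "mdeg (Poly_Mapping.single I n) = n"
  by (simp add: mdeg_def lookup_single when_def)

lemma homogeneous_zero: "homogeneous d 0"
  by (simp add: homogeneous_iff)

lemma homogeneous_single: "mdeg m = d \<Longrightarrow> homogeneous d (Poly_Mapping.single m c)"
  by (simp add: homogeneous_iff)

lemma homogeneous_const: "homogeneous 0 (const c)"
  unfolding const_def by (rule homogeneous_single) (simp add: mdeg_def)

lemma homogeneous_one: "homogeneous 0 1"
  using homogeneous_const[of 1] by (simp add: const_one)

lemma homogeneous_var: "homogeneous 1 (var I)"
  unfolding var_def by (rule homogeneous_single) (rule mdeg_single)

lemma homogeneous_add: "homogeneous d p \<Longrightarrow> homogeneous d q \<Longrightarrow> homogeneous d (p + q)"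
  using keys_add[of p q] unfolding homogeneous_iff by blast

lemma homogeneous_uminus: "homogeneous d p \<Longrightarrow> homogeneous d (- p)"
  by (simp add: homogeneous_iff in_keys_iff)

lemma homogeneous_diff: "homogeneous d p \<Longrightarrow> homogeneous d q \<Longrightarrow> homogeneous d (p - q)"
  using homogeneous_add[of d p "- q"] homogeneous_uminus[of d q] by simp

lemma homogeneous_sum: "(\<And>x. x \<in> S \<Longrightarrow> homogeneous d (f x)) \<Longrightarrow> homogeneous d (sum f S)"
  by (induction S rule: infinite_finite_induct) (simp_all add: homogeneous_zero homogeneous_add)

lemma homogeneous_mult: "homogeneous d p \<Longrightarrow> homogeneous e q \<Longrightarrow> homogeneous (d + e) (p * q)"
  using keys_mult[of p q] unfolding homogeneous_iff by (fastforce simp: mdeg_add)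

lemma homogeneous_const_mult: "homogeneous d p \<Longrightarrow> homogeneous d (const c * p)"
  using homogeneous_mult[OF homogeneous_const, of d p] by simp

lemma homogeneous_power: "homogeneous d p \<Longrightarrow> homogeneous (n * d) (p ^ n)"
  by (induction n) (simp_all add: homogeneous_one homogeneous_mult)

lemma homogeneous_prod:
  "(\<And>x. x \<in> S \<Longrightarrow> homogeneous (e x) (f x)) \<Longrightarrow> homogeneous (\<Sum>x\<in>S. e x) (\<Prod>x\<in>S. f x)"
  by (induction S rule: infinite_finite_induct) (simp_all add: homogeneous_one homogeneous_mult)

lemma homogeneous_lin: "homogeneous 1 (lin v)"
  unfolding lin_def by (intro homogeneous_sum homogeneous_const_mult homogeneous_var)

lemma homogeneous_sym_map:
  assumes "homogeneous d p"
  shows "homogeneous d (sym_map f p)"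
  unfolding sym_map_def
proof (intro homogeneous_sum homogeneous_const_mult)
  fix m assume "m \<in> Poly_Mapping.keys p"
  then have "mdeg m = d" using assms by (simp add: homogeneous_iff)
  moreover have "homogeneous (\<Sum>I\<in>UNIV. Poly_Mapping.lookup m I * 1)
      (\<Prod>I\<in>UNIV. lin (f (axis I 1)) ^ Poly_Mapping.lookup m I)"
    by (intro homogeneous_prod homogeneous_power homogeneous_lin)
  ultimately show "homogeneous d (\<Prod>I\<in>UNIV. lin (f (axis I 1)) ^ Poly_Mapping.lookup m I)"
    by (simp add: mdeg_def)
qed

text \<open>A cluster point will be matched with a point of the surface only up to a nonzero factor;
  homogeneity makes that factor harmless for the vanishing of a form.\<close>

lemma peval_scale:
  assumes "homogeneous d p"
  shows "peval (\<lambda>I. c * z I) p = c ^ d * peval z p"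
proof -
  have "(\<Prod>I\<in>UNIV. (c * z I) ^ Poly_Mapping.lookup m I) =
      c ^ d * (\<Prod>I\<in>UNIV. z I ^ Poly_Mapping.lookup m I)" if "m \<in> Poly_Mapping.keys p" for m
    using that assms
    by (simp add: homogeneous_iff mdeg_def power_mult_distrib prod.distrib flip: power_sum)
  then show ?thesis
    unfolding peval_def sum_distrib_left by (intro sum.cong) simp_all
qed

lemma sum_singles: "(\<Sum>m\<in>Poly_Mapping.keys p. Poly_Mapping.single m (Poly_Mapping.lookup p m)) = p"
  by (rule poly_mapping_eqI) (simp add: lookup_sum lookup_single when_def in_keys_iff)

lemma tendsto_peval:
  assumes "\<And>I. ((\<lambda>t. z t I) \<longlongrightarrow> w I) F"
  shows "((\<lambda>t. peval (z t) p) \<longlongrightarrow> peval w p) F"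
  unfolding peval_def by (intro tendsto_intros assms)

interpretation sym: module "(*) :: symV \<Rightarrow> symV \<Rightarrow> symV"
  by unfold_locales (simp_all add: algebra_simps)

lemmas ideal_base = sym.span_base[folded ideal_generated_def]
lemmas ideal_zero = sym.span_zero[folded ideal_generated_def]
lemmas ideal_add = sym.span_add[folded ideal_generated_def]
lemmas ideal_diff = sym.span_diff[folded ideal_generated_def]
lemmas ideal_sum = sym.span_sum[folded ideal_generated_def]
lemmas ideal_mult = sym.span_scale[folded ideal_generated_def]
lemmas ideal_induct = sym.span_induct_alt[folded ideal_generated_def, consumes 1, case_names zero step]

lemma ideal_mono_closed: "S \<subseteq> ideal_generated T \<Longrightarrow> ideal_generated S \<subseteq> ideal_generated T"
  unfolding ideal_generated_def by (rule sym.span_minimal) simp_all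

lemma ideal_vanishes:
  assumes "p \<in> ideal_generated S" "\<And>q. q \<in> S \<Longrightarrow> peval z q = 0"
  shows "peval z p = 0"
  using assms(1) by (induction rule: ideal_induct) (simp_all add: peval_simps assms(2))

lemma sym_map_ideal:
  assumes "p \<in> ideal_generated S" "\<And>q. q \<in> S \<Longrightarrow> sym_map f q \<in> ideal_generated T"
  shows "sym_map f p \<in> ideal_generated T"
  using assms(1)
proof (induction rule: ideal_induct)
  case zero
  show ?case using sym_map_const[of f 0] by (simp add: const_zero ideal_zero)
next
  case (step c x y)
  then show ?case by (simp add: sym_map_add sym_map_mult ideal_add ideal_mult assms(2))
qed


section \<open>The cluster coordinates\<close>

text \<open>Here \<open>I12\<close> stands for \<open>c = s\<^sub>1\<^sub>2\<close>, whose divisor is a pentagon of lines, and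
  \<open>I13, I21, I23, I31, I32\<close> stand for \<open>y\<^sub>0, \<dots>, y\<^sub>4\<close>, cyclically permuted by \<open>rot\<close>.\<close>

primrec rot :: "idx \<Rightarrow> idx" where
  "rot I12 = I12" | "rot I13 = I21" | "rot I21 = I23" | "rot I23 = I31" | "rot I31 = I32" | "rot I32 = I13"

definition cluster_rel :: "idx \<Rightarrow> symV" where
  "cluster_rel I = var I * var (rot (rot I)) - var I12 * (var I12 + var (rot I))"

definition cluster_rels :: "symV set" where
  "cluster_rels = cluster_rel ` (- {I12})"

text \<open>A dense family of test points. Nonvanishing of \<open>z I12\<close> lets the induction
  on the degree cancel c, and nonvanishing of the other coordinates lets a point of the plane be
  recovered from them.\<close>

definition cluster_pt :: "(idx \<Rightarrow> complex) \<Rightarrow> bool" where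
  "cluster_pt z \<longleftrightarrow> z I12 \<noteq> 0 \<and> (\<forall>I. z I \<noteq> 0) \<and>
     (\<forall>I. I \<noteq> I12 \<longrightarrow> z I * z (rot (rot I)) = z I12 * (z I12 + z (rot I)))"

lemma peval_cluster_rel:
  "peval z (cluster_rel I) = z I * z (rot (rot I)) - z I12 * (z I12 + z (rot I))"
  by (simp add: cluster_rel_def peval_simps)

lemma rot_neq: "I \<noteq> I12 \<Longrightarrow> rot I \<noteq> I" "I \<noteq> I12 \<Longrightarrow> rot I \<noteq> I12" "I \<noteq> I12 \<Longrightarrow> rot (rot I) \<noteq> I"
  by (cases I; simp)+

text \<open>For \<open>I\<close> other than \<open>I12\<close> these are the monomials that do not
  vanish identically on one side of the pentagon, the line on which only the coordinates
  \<open>I\<close> and \<open>rot I\<close> may be nonzero.\<close>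

definition edge :: "idx \<Rightarrow> (idx \<Rightarrow>\<^sub>0 nat) \<Rightarrow> bool" where
  "edge I m \<longleftrightarrow> (\<forall>J. J \<noteq> I \<and> J \<noteq> rot I \<longrightarrow> Poly_Mapping.lookup m J = 0)"

text \<open>Two vertices of a pentagon at distance two are exactly the non-adjacent ones. The
  support of \<open>m\<close> is thus a set of pairwise adjacent vertices of a 5-cycle, hence
  contained in an edge.\<close>

lemma edge_cases:
  assumes "Poly_Mapping.lookup m I12 = 0"
    and "\<And>I. I \<noteq> I12 \<Longrightarrow> Poly_Mapping.lookup m I = 0 \<or> Poly_Mapping.lookup m (rot (rot I)) = 0"
  obtains I where "I \<noteq> I12" "edge I m"
proof -
  have ex: "(\<exists>I. P I) \<longleftrightarrow> P I12 \<or> P I13 \<or> P I21 \<or> P I23 \<or> P I31 \<or> P I32" for P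
    using idx.exhaust by metis
  have "\<exists>I. I \<noteq> I12 \<and> edge I m"
    using assms(1) assms(2)[of I13] assms(2)[of I21] assms(2)[of I23] assms(2)[of I31] assms(2)[of I32]
    by (simp add: ex edge_def all_idx) blast
  then show thesis using that by blast
qed

lemma single_var:
  assumes "Poly_Mapping.lookup m I > 0"
  obtains m' where "m = Poly_Mapping.single I 1 + m'"
    "\<And>c. Poly_Mapping.single m c = var I * Poly_Mapping.single m' c"
    "mdeg m = Suc (mdeg m')"
    "\<And>J. J \<noteq> I \<Longrightarrow> Poly_Mapping.lookup m' J = Poly_Mapping.lookup m J"
proof -
  have m: "m = Poly_Mapping.single I 1 + (m - Poly_Mapping.single I 1)"
    using assms by (intro poly_mapping_eqI) (auto simp: lookup_add lookup_minus lookup_single when_def)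
  show thesis
  proof (rule that[OF m])
    show "Poly_Mapping.single m c = var I * Poly_Mapping.single (m - Poly_Mapping.single I 1) c" for c
      by (subst m) (simp add: var_def mult_single)
    show "mdeg m = Suc (mdeg (m - Poly_Mapping.single I 1))"
      by (subst m) (simp only: mdeg_add mdeg_single plus_1_eq_Suc)
    show "Poly_Mapping.lookup (m - Poly_Mapping.single I 1) J = Poly_Mapping.lookup m J"
      if "J \<noteq> I" for J
      using that by (simp add: lookup_minus lookup_single)
  qed
qed

text \<open>In degree 0 truncated subtraction would let \<open>G\<close> be a nonzero constant, so
  \<open>G = 0\<close> is demanded there separately.\<close>

definition edge_reduction :: "nat \<Rightarrow> symV \<Rightarrow> symV \<Rightarrow> symV \<Rightarrow> bool" where
  "edge_reduction d p E G \<longleftrightarrow>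
     p - E - var I12 * G \<in> ideal_generated cluster_rels \<and> homogeneous d E \<and>
     (\<forall>m\<in>Poly_Mapping.keys E. \<exists>I. I \<noteq> I12 \<and> edge I m) \<and> homogeneous (d - 1) G \<and> (d = 0 \<longrightarrow> G = 0)"

text \<open>A monomial containing c goes into \<open>G\<close>. One containing a non-adjacent pair
  becomes a multiple of c after a single use of a relation, so no iterated rewriting or termination
  argument arises. Any other monomial is an edge monomial.\<close>

lemma edge_reduction_monomial:
  assumes d: "mdeg m = d"
  shows "\<exists>E G. edge_reduction d (Poly_Mapping.single m c) E G"
proof (cases "Poly_Mapping.lookup m I12 > 0")
  case True
  then obtain m' where m': "\<And>c. Poly_Mapping.single m c = var I12 * Poly_Mapping.single m' c"
    "mdeg m = Suc (mdeg m')"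
    by (rule single_var) blast
  have "edge_reduction d (Poly_Mapping.single m c) 0 (Poly_Mapping.single m' c)"
    using m'(2) d
    by (simp add: edge_reduction_def m'(1) ideal_zero homogeneous_zero homogeneous_single)
  then show ?thesis by blast
next
  case no_I12: False
  show ?thesis
  proof (cases "\<exists>I. I \<noteq> I12 \<and> Poly_Mapping.lookup m I > 0 \<and> Poly_Mapping.lookup m (rot (rot I)) > 0")
    case True
    then obtain I where I: "I \<noteq> I12" "Poly_Mapping.lookup m I > 0"
      and I2: "Poly_Mapping.lookup m (rot (rot I)) > 0"
      by blast
    \<comment> \<open>The two variables are distinct, so splitting off the first leaves the exponent
      of the second positive.\<close>
    obtain m' where m': "\<And>c. Poly_Mapping.single m c = var I * Poly_Mapping.single m' c"
      "mdeg m = Suc (mdeg m')" "Poly_Mapping.lookup m' (rot (rot I)) = Poly_Mapping.lookup m (rot (rot I))"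
      using I(2) by (rule single_var) (metis rot_neq(3)[OF I(1)])
    obtain m'' where m'': "\<And>c. Poly_Mapping.single m' c = var (rot (rot I)) * Poly_Mapping.single m'' c"
      "mdeg m' = Suc (mdeg m'')"
      using I2[folded m'(3)] by (rule single_var) blast
    define M where "M = Poly_Mapping.single m'' c"
    have M: "homogeneous (mdeg m'') M"
      unfolding M_def by (rule homogeneous_single) simp
    have d': "d - 1 = 1 + mdeg m''" "d \<noteq> 0"
      using d m'(2) m''(2) by simp_all
    \<comment> \<open>The right side of the relation is divided by c and multiplied by the remaining
      monomial.\<close>
    let ?G = "(var I12 + var (rot I)) * M"
    have "Poly_Mapping.single m c - 0 - var I12 * ?G = M * cluster_rel I"
      unfolding m'(1) m''(1) cluster_rel_def M_def[symmetric] by (simp only: ring_distribs mult_ac diff_0_right)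
    also have "\<dots> \<in> ideal_generated cluster_rels"
      using I(1) by (intro ideal_mult ideal_base) (auto simp: cluster_rels_def)
    finally have "edge_reduction d (Poly_Mapping.single m c) 0 ?G"
      using homogeneous_mult[OF homogeneous_add[OF homogeneous_var homogeneous_var] M] d'(2)
      unfolding edge_reduction_def d'(1) by (simp add: homogeneous_zero)
    then show ?thesis by blast
  next
    case False
    have "Poly_Mapping.lookup m I12 = 0"
      using no_I12 by simp
    moreover have "Poly_Mapping.lookup m I = 0 \<or> Poly_Mapping.lookup m (rot (rot I)) = 0"
      if "I \<noteq> I12" for I
      using False that by (metis gr0I)
    ultimately obtain I where "I \<noteq> I12" "edge I m"
      by (rule edge_cases)
    then have "edge_reduction d (Poly_Mapping.single m c) (Poly_Mapping.single m c) 0"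
      using d by (auto simp: edge_reduction_def ideal_zero homogeneous_zero homogeneous_single)
    then show ?thesis by blast
  qed
qed

lemma edge_reduction_exists:
  assumes "homogeneous d p"
  obtains E G where "edge_reduction d p E G"
proof -
  have "\<forall>m\<in>Poly_Mapping.keys p. \<exists>E G.
      edge_reduction d (Poly_Mapping.single m (Poly_Mapping.lookup p m)) E G"
    using assms edge_reduction_monomial unfolding homogeneous_iff by blast
  then obtain E G where EG: "\<And>m. m \<in> Poly_Mapping.keys p \<Longrightarrow>
      edge_reduction d (Poly_Mapping.single m (Poly_Mapping.lookup p m)) (E m) (G m)"
    by metis
  let ?K = "Poly_Mapping.keys p"
  have "(\<Sum>m\<in>?K. Poly_Mapping.single m (Poly_Mapping.lookup p m) - E m - var I12 * G m) \<in>
      ideal_generated cluster_rels"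
    using EG by (intro ideal_sum) (simp add: edge_reduction_def)
  then have "p - sum E ?K - var I12 * sum G ?K \<in> ideal_generated cluster_rels"
    by (simp add: sum_subtractf sum_singles sum_distrib_left)
  moreover have "homogeneous d (sum E ?K)" "homogeneous (d - 1) (sum G ?K)"
    using EG by (auto intro!: homogeneous_sum simp: edge_reduction_def)
  moreover have "\<exists>I. I \<noteq> I12 \<and> edge I m" if "m \<in> Poly_Mapping.keys (sum E ?K)" for m
  proof -
    have "Poly_Mapping.lookup (sum E ?K) m \<noteq> 0"
      using that by (simp add: in_keys_iff)
    then obtain k where "k \<in> ?K" "Poly_Mapping.lookup (E k) m \<noteq> 0"
      unfolding lookup_sum by (meson sum.neutral)
    then show ?thesis
      using EG[of k] by (auto simp: edge_reduction_def in_keys_iff)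
  qed
  moreover have "sum G ?K = 0" if "d = 0"
    using EG that by (intro sum.neutral) (simp add: edge_reduction_def)
  ultimately have "edge_reduction d p (sum E ?K) (sum G ?K)"
    by (simp add: edge_reduction_def)
  then show thesis by (rule that)
qed

section \<open>Degeneration of cluster points to the pentagon of lines\<close>

definition line_pt :: "idx \<Rightarrow> complex \<Rightarrow> idx \<Rightarrow> complex" where
  "line_pt I b K = (if K = I then 1 else if K = rot I then b else 0)"

text \<open>The relations are written along the orbit of \<open>rot\<close> that starts at
  \<open>I\<close>, so that one argument serves all five sides of the pentagon.\<close>

lemma cluster_ptI:
  assumes I: "I \<noteq> I12"
    and nz: "z I12 \<noteq> 0" "z I \<noteq> 0" "z (rot I) \<noteq> 0" "z (rot (rot I)) \<noteq> 0"
      "z (rot (rot (rot I))) \<noteq> 0" "z (rot (rot (rot (rot I)))) \<noteq> 0"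
    and eq: "z I * z (rot (rot I)) = z I12 * (z I12 + z (rot I))"
      "z (rot I) * z (rot (rot (rot I))) = z I12 * (z I12 + z (rot (rot I)))"
      "z (rot (rot I)) * z (rot (rot (rot (rot I)))) = z I12 * (z I12 + z (rot (rot (rot I))))"
      "z (rot (rot (rot I))) * z I = z I12 * (z I12 + z (rot (rot (rot (rot I)))))"
      "z (rot (rot (rot (rot I)))) * z (rot I) = z I12 * (z I12 + z I)"
  shows "cluster_pt z"
proof -
  have cover: "J = I \<or> J = rot I \<or> J = rot (rot I) \<or> J = rot (rot (rot I)) \<or>
      J = rot (rot (rot (rot I)))" if "J \<noteq> I12" for J
    using I that by (cases I; cases J) simp_all
  have period: "rot (rot (rot (rot (rot I)))) = I"
    by (cases I) simp_all
  have "z J \<noteq> 0" for J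
    using cover[of J] nz by (cases "J = I12") auto
  moreover have "z J * z (rot (rot J)) = z I12 * (z I12 + z (rot J))" if "J \<noteq> I12" for J
    using cover[OF that] eq by (elim disjE) (simp_all only: period)
  ultimately show ?thesis
    using nz(1) by (simp add: cluster_pt_def)
qed

text \<open>The solution of the relations with c = t and two adjacent coordinates equal to 1 and b.
  The other three coordinates are obtained by solving three of the relations; all of them tend to 0
  with t.\<close>

definition line_family :: "idx \<Rightarrow> complex \<Rightarrow> complex \<Rightarrow> idx \<Rightarrow> complex" where
  "line_family I b t K = (if K = I12 then t else if K = I then 1 else if K = rot I then b
    else if K = rot (rot I) then t * (t + b)
    else if K = rot (rot (rot I)) then t\<^sup>2 * (t + (1 + b)) / b else t * (t + 1) / b)"

lemma line_family_simps:
  assumes "I \<noteq> I12"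
  shows "line_family I b t I12 = t" "line_family I b t I = 1" "line_family I b t (rot I) = b"
    "line_family I b t (rot (rot I)) = t * (t + b)"
    "line_family I b t (rot (rot (rot I))) = t\<^sup>2 * (t + (1 + b)) / b"
    "line_family I b t (rot (rot (rot (rot I)))) = t * (t + 1) / b"
  using assms by (cases I; simp add: line_family_def)+

text \<open>The excluded values are those at which a coordinate vanishes or the formulas divide by
  0. Three relations hold by construction of the family; the remaining two express the 5-periodicity
  of the recurrence.\<close>

lemma cluster_pt_line_family:
  assumes I: "I \<noteq> I12" and "t \<noteq> 0" and b: "b \<noteq> 0" and "t \<noteq> - b" "t \<noteq> - 1" "t \<noteq> - (1 + b)"
  shows "cluster_pt (line_family I b t)"
proof -
  have nz: "t + b \<noteq> 0" "t + 1 \<noteq> 0" "t + (1 + b) \<noteq> 0"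
    using assms(4-6) by (simp_all only: eq_neg_iff_add_eq_0 not_False_eq_True)
  have eq: "b * (t\<^sup>2 * (t + (1 + b)) / b) = t * (t + t * (t + b))"
    "t * (t + b) * (t * (t + 1) / b) = t * (t + t\<^sup>2 * (t + (1 + b)) / b)"
    "t\<^sup>2 * (t + (1 + b)) / b * 1 = t * (t + t * (t + 1) / b)"
    using b by (simp_all add: field_simps power2_eq_square)
  have "t * (t + b) \<noteq> 0" "t\<^sup>2 * (t + (1 + b)) / b \<noteq> 0" "t * (t + 1) / b \<noteq> 0"
    and "1 * (t * (t + b)) = t * (t + b)" "t * (t + 1) / b * b = t * (t + 1)"
    using \<open>t \<noteq> 0\<close> b nz by simp_all
  then show ?thesis
    using \<open>t \<noteq> 0\<close> b eq by (intro cluster_ptI[OF I]) (simp_all only: line_family_simps[OF I] one_neq_zero simp_thms)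
qed

lemma isCont_if: "isCont f x \<Longrightarrow> isCont g x \<Longrightarrow> isCont (\<lambda>t. if c then f t else g t) x"
  by (cases c) simp_all

text \<open>A point of the line is the limit of \<open>line_family\<close> as t tends to 0, the
  family consists of cluster points for all t close to 0 and different from it, and polynomials are
  continuous.\<close>

lemma vanishes_on_lines:
  assumes van: "\<And>z. cluster_pt z \<Longrightarrow> peval z p = 0" and "I \<noteq> I12" "b \<noteq> 0" "b \<noteq> - 1"
  shows "peval (line_pt I b) p = 0"
proof -
  have ev: "eventually (\<lambda>t. t \<noteq> a) (at 0)" for a :: complex
    by (rule eventually_neq_at_within)
  have "eventually (\<lambda>t. peval (line_family I b t) p = 0) (at 0)"
    using ev[of 0] ev[of "- b"] ev[of "- 1"] ev[of "- (1 + b)"]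
  proof eventually_elim
    case (elim t)
    then show ?case
      using assms(2,3) by (intro van cluster_pt_line_family)
  qed
  then have "((\<lambda>t. peval (line_family I b t) p) \<longlongrightarrow> 0) (at 0)"
    by (rule tendsto_eventually)
  moreover have "((\<lambda>t. peval (line_family I b t) p) \<longlongrightarrow> peval (line_pt I b) p) (at 0)"
  proof (rule tendsto_peval)
    fix K
    have "isCont (\<lambda>t. line_family I b t K) 0"
      using assms(3) unfolding line_family_def by (intro isCont_if continuous_intros)
    moreover have "line_family I b 0 K = line_pt I b K"
      using assms(2) rot_neq[OF assms(2)] by (simp add: line_family_def line_pt_def)
    ultimately show "((\<lambda>t. line_family I b t K) \<longlongrightarrow> line_pt I b K) (at 0)"
      by (simp add: isCont_def)
  qed
  ultimately show ?thesis
    by (metis tendsto_unique trivial_limit_at)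
qed

lemma prod_line_pt:
  assumes "I \<noteq> I12"
  shows "(\<Prod>K\<in>UNIV. line_pt I b K ^ Poly_Mapping.lookup m K) =
    (if edge I m then b ^ Poly_Mapping.lookup m (rot I) else 0)"
proof (cases "edge I m")
  case True
  have "(\<Prod>K\<in>UNIV. line_pt I b K ^ Poly_Mapping.lookup m K) =
      (\<Prod>K\<in>UNIV. if K = rot I then b ^ Poly_Mapping.lookup m (rot I) else 1)"
    using True rot_neq[OF assms] by (intro prod.cong) (auto simp: line_pt_def edge_def)
  then show ?thesis using True by simp
next
  case False
  then obtain J where "J \<noteq> I" "J \<noteq> rot I" "Poly_Mapping.lookup m J \<noteq> 0"
    by (auto simp: edge_def)
  then have "line_pt I b J ^ Poly_Mapping.lookup m J = 0"
    by (simp add: line_pt_def)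
  then show ?thesis using False by (auto intro!: prod_zero)
qed

lemma mdeg_edge:
  assumes "I \<noteq> I12" "edge I m"
  shows "mdeg m = Poly_Mapping.lookup m I + Poly_Mapping.lookup m (rot I)"
proof -
  have "mdeg m = (\<Sum>K\<in>{I, rot I}. Poly_Mapping.lookup m K)"
    unfolding mdeg_def using assms(2) by (intro sum.mono_neutral_right) (auto simp: edge_def)
  then show ?thesis using rot_neq(1)[OF assms(1)] by simp
qed

text \<open>On the side of the pentagon belonging to a given monomial \<open>n\<close>, only the
  monomials of that edge survive, and \<open>E\<close> becomes a polynomial in b with infinitely
  many zeros. Since the total degree is fixed, the exponent of b determines the edge monomial, so
  each coefficient of this polynomial is a single coefficient of \<open>E\<close>.\<close>

lemma edge_polynomial_zero:
  assumes hom: "homogeneous d E"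
    and edges: "\<And>m. m \<in> Poly_Mapping.keys E \<Longrightarrow> \<exists>I. I \<noteq> I12 \<and> edge I m"
    and van: "\<And>I b. I \<noteq> I12 \<Longrightarrow> b \<noteq> 0 \<Longrightarrow> b \<noteq> - 1 \<Longrightarrow> peval (line_pt I b) E = 0"
  shows "E = 0"
proof (rule ccontr)
  assume "E \<noteq> 0"
  then obtain n where n: "n \<in> Poly_Mapping.keys E"
    by (metis ex_in_conv keys_eq_empty)
  then obtain I where I: "I \<noteq> I12" "edge I n"
    using edges by blast
  define q where "q = (\<Sum>m\<in>Poly_Mapping.keys E. if edge I m
    then monom (Poly_Mapping.lookup E m) (Poly_Mapping.lookup m (rot I)) else 0)"
  have "poly q b = peval (line_pt I b) E" for b
    unfolding q_def peval_def prod_line_pt[OF I(1)] poly_sum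
    by (intro sum.cong) (simp_all add: poly_monom)
  then have "- {0, - 1} \<subseteq> {b. poly q b = 0}"
    using van[OF I(1)] by auto
  moreover have "infinite (- {0, - 1 :: complex})"
    by (metis finite.emptyI finite.insertI finite_compl infinite_UNIV_char_0)
  ultimately have "q = 0"
    using poly_roots_finite finite_subset by blast
  have "coeff q (Poly_Mapping.lookup n (rot I)) =
      (\<Sum>m\<in>Poly_Mapping.keys E. if m = n then Poly_Mapping.lookup E n else 0)"
    unfolding q_def coeff_sum
  proof (rule sum.cong[OF refl])
    fix m assume m: "m \<in> Poly_Mapping.keys E"
    have "m = n" if e: "edge I m" and r: "Poly_Mapping.lookup m (rot I) = Poly_Mapping.lookup n (rot I)"
    proof (rule poly_mapping_eqI)
      have "mdeg m = mdeg n"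
        using hom m n by (simp add: homogeneous_iff)
      then have "Poly_Mapping.lookup m I = Poly_Mapping.lookup n I"
        using mdeg_edge[OF I(1) e] mdeg_edge[OF I] r by simp
      then show "Poly_Mapping.lookup m J = Poly_Mapping.lookup n J" for J
        using e I(2) r by (cases "J = I \<or> J = rot I") (auto simp: edge_def)
    qed
    then show "coeff (if edge I m then monom (Poly_Mapping.lookup E m) (Poly_Mapping.lookup m (rot I))
        else 0) (Poly_Mapping.lookup n (rot I)) = (if m = n then Poly_Mapping.lookup E n else 0)"
      using I(2) by auto
  qed
  also have "\<dots> = Poly_Mapping.lookup E n"
    using n by simp
  finally show False
    using n \<open>q = 0\<close> by (simp add: in_keys_iff)
qed

lemma peval_edge_reduction:
  assumes "edge_reduction d p E G" "\<And>J. J \<noteq> I12 \<Longrightarrow> peval z (cluster_rel J) = 0"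
  shows "peval z p = peval z E + z I12 * peval z G"
proof -
  have "p - E - var I12 * G \<in> ideal_generated cluster_rels"
    using assms(1) by (simp add: edge_reduction_def)
  then have "peval z (p - E - var I12 * G) = 0"
    by (rule ideal_vanishes) (use assms(2) in \<open>auto simp: cluster_rels_def\<close>)
  then show ?thesis by (simp add: peval_simps diff_diff_eq)
qed

text \<open>Where c = 0 a relation only says that the product of two non-adjacent coordinates is 0,
  and the coordinates that may be nonzero here are adjacent.\<close>

lemma line_pt_cluster_rel:
  assumes "I \<noteq> I12" "J \<noteq> I12"
  shows "peval (line_pt I b) (cluster_rel J) = 0"
  using assms by (cases I; cases J) (simp_all add: peval_cluster_rel line_pt_def)

lemma vanishing_imp_in_ideal:
  assumes "homogeneous d p" "\<And>z. cluster_pt z \<Longrightarrow> peval z p = 0"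
  shows "p \<in> ideal_generated cluster_rels"
  using assms
proof (induction d arbitrary: p rule: less_induct)
  case (less d)
  obtain E G where EG: "edge_reduction d p E G"
    using less.prems(1) by (rule edge_reduction_exists)
  \<comment> \<open>On the pentagon c = 0, so \<open>p\<close> and \<open>E\<close> have the same
    values there.\<close>
  have "peval (line_pt I b) E = 0" if "I \<noteq> I12" "b \<noteq> 0" "b \<noteq> - 1" for I b
    using peval_edge_reduction[OF EG line_pt_cluster_rel[OF that(1)]]
      vanishes_on_lines[OF less.prems(2) that] that(1) rot_neq(2)[OF that(1)]
    by (simp add: line_pt_def)
  then have E: "E = 0"
    using EG by (intro edge_polynomial_zero[of d]) (auto simp: edge_reduction_def)
  have "G \<in> ideal_generated cluster_rels"
  proof (cases "d = 0")
    case True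
    then show ?thesis using EG by (simp add: edge_reduction_def ideal_zero)
  next
    case False
    \<comment> \<open>With \<open>E = 0\<close> the value of \<open>p\<close> is c times that of
      \<open>G\<close>, and c is nonzero at a cluster point; so \<open>G\<close> satisfies the
      hypotheses in degree \<open>d - 1\<close>.\<close>
    have "peval z G = 0" if "cluster_pt z" for z
      using peval_edge_reduction[OF EG, of z] less.prems(2)[OF that] that
      by (simp add: E cluster_pt_def peval_cluster_rel peval_simps)
    then show ?thesis
      using False EG by (intro less.IH[of "d - 1"]) (auto simp: edge_reduction_def)
  qed
  then have "(p - E - var I12 * G) + var I12 * G \<in> ideal_generated cluster_rels"
    using EG by (intro ideal_add ideal_mult) (simp add: edge_reduction_def)
  then show ?case by (simp add: E)
qed


section \<open>The Pfaffians\<close>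

definition lin_ext :: "(idx \<Rightarrow> complex ^ idx) \<Rightarrow> complex ^ idx \<Rightarrow> complex ^ idx" where
  "lin_ext w v = (\<Sum>I\<in>UNIV. (v $ I) *s w I)"

text \<open>The coordinates are chosen so that c and all five y's, written as cubics, are products
  of linear forms of lines joining two base points, up to sign; see
  \<open>to_cluster_cubic\<close>.\<close>

primrec cluster_vec :: "idx \<Rightarrow> complex ^ idx" where
  "cluster_vec I12 = axis I12 1"
| "cluster_vec I13 = axis I31 1 - axis I21 1"
| "cluster_vec I21 = axis I21 1 - axis I12 1"
| "cluster_vec I23 = axis I32 1 - axis I12 1"
| "cluster_vec I31 = axis I23 1 - axis I32 1"
| "cluster_vec I32 = - axis I12 1 - axis I13 1"

text \<open>The inverse change of basis, found by solving the equations of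
  \<open>cluster_vec\<close> for the original basis vectors.\<close>

primrec uncluster_vec :: "idx \<Rightarrow> complex ^ idx" where
  "uncluster_vec I12 = axis I12 1"
| "uncluster_vec I13 = - axis I12 1 - axis I32 1"
| "uncluster_vec I21 = axis I12 1 + axis I21 1"
| "uncluster_vec I23 = axis I12 1 + axis I23 1 + axis I31 1"
| "uncluster_vec I31 = axis I12 1 + axis I13 1 + axis I21 1"
| "uncluster_vec I32 = axis I12 1 + axis I23 1"

lemma linear_lin_ext: "Vector_Spaces.linear (*s) (*s) (lin_ext w)"
proof -
  have "lin_ext w (u + v) = lin_ext w u + lin_ext w v" for u v
    by (simp add: lin_ext_def vec.scale_left_distrib sum.distrib)
  moreover have "lin_ext w (c *s v) = c *s lin_ext w v" for c v
    by (simp add: lin_ext_def vec.scale_sum_right)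
  ultimately show ?thesis
    by unfold_locales (simp_all add: vec.scale_right_distrib vec.scale_left_distrib)
qed

lemma lin_ext_axis: "lin_ext w (axis I 1) = w I"
proof -
  have "lin_ext w (axis I 1) = (\<Sum>J\<in>UNIV. if J = I then w I else 0)"
    unfolding lin_ext_def by (intro sum.cong) (auto simp: axis_def)
  then show ?thesis by simp
qed

lemma lin_ext_cluster_uncluster: "lin_ext cluster_vec (uncluster_vec I) = axis I 1"
proof -
  interpret Vector_Spaces.linear "(*s)" "(*s)" "lin_ext cluster_vec"
    by (rule linear_lin_ext)
  show ?thesis
    by (cases I) (simp_all add: add diff neg lin_ext_axis)
qed

lemma sym_map_cluster_uncluster:
  "sym_map (lin_ext cluster_vec) (sym_map (lin_ext uncluster_vec) p) = p"
proof -
  have "sym_map (lin_ext cluster_vec) (sym_map (lin_ext uncluster_vec) p) = sym_map id p"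
    unfolding sym_map_comp[OF linear_lin_ext]
    by (simp add: sym_map_def lin_ext_axis lin_ext_cluster_uncluster)
  then show ?thesis by (simp add: sym_map_id)
qed

definition quadric :: "idx \<Rightarrow> symV" where
  "quadric I = sym_map (lin_ext cluster_vec) (cluster_rel I)"

lemma sym_map_diff: "sym_map f (p - q) = sym_map f p - sym_map f q"
  by (simp add: sym_map_eq_eval_in smap.eval_diff)

lemma quadric_eq:
  "quadric I = lin (cluster_vec I) * lin (cluster_vec (rot (rot I)))
    - lin (cluster_vec I12) * (lin (cluster_vec I12) + lin (cluster_vec (rot I)))"
  by (simp add: quadric_def cluster_rel_def sym_map_diff sym_map_add sym_map_mult sym_map_var
      lin_ext_axis del: cluster_vec.simps)

text \<open>Stated for arbitrary elements of a commutative ring, so that the check is pure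
  polynomial arithmetic in six unknowns. The fifteen Pfaffians come in lexicographic order of their
  index quadruples, each as twice an integral combination of the five quadrics.\<close>

lemma pfaffian_identities:
  fixes v q :: "idx \<Rightarrow> 'a::comm_ring_1" and A :: "idx \<Rightarrow> idx \<Rightarrow> 'a"
  assumes A:
    "A I12 I13 = v I21 + v I23 - v I31 - v I32" "A I12 I21 = v I12 + v I31 - v I32 - v I21" "A I12 I23 = - v I13 - v I21"
    "A I12 I31 = v I13 + v I32" "A I12 I32 = v I21 + v I32 - v I12 - v I23" "A I13 I21 = v I12 + v I23"
    "A I13 I23 = v I31 + v I23 - v I13 - v I32" "A I13 I31 = v I13 + v I21 - v I23 - v I31" "A I13 I32 = - v I12 - v I31"
    "A I21 I23 = v I12 + v I13 - v I32 - v I31" "A I21 I31 = v I12 - v I21 + v I31 - v I13" "A I21 I32 = v I23 + v I31"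
    "A I23 I31 = - v I21 - v I32" "A I23 I32 = v I23 + v I12 - v I13 - v I32" "A I31 I32 = v I12 + v I13 - v I21 - v I23"
    and q:
    "q I13 = (v I31 - v I21) * (v I32 - v I12) - v I12 * (v I12 + (v I21 - v I12))"
    "q I21 = (v I21 - v I12) * (v I23 - v I32) - v I12 * (v I12 + (v I32 - v I12))"
    "q I23 = (v I32 - v I12) * (- v I12 - v I13) - v I12 * (v I12 + (v I23 - v I32))"
    "q I31 = (v I23 - v I32) * (v I31 - v I21) - v I12 * (v I12 + (- v I12 - v I13))"
    "q I32 = (- v I12 - v I13) * (v I21 - v I12) - v I12 * (v I12 + (v I31 - v I21))"
  shows
    "A I12 I13 * A I21 I23 - A I12 I21 * A I13 I23 + A I12 I23 * A I13 I21 =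
      2 * (q I13 + q I23 - q I21 - q I31)"
    "A I12 I13 * A I21 I31 - A I12 I21 * A I13 I31 + A I12 I31 * A I13 I21 =
      2 * (q I31 - q I23)"
    "A I12 I13 * A I21 I32 - A I12 I21 * A I13 I32 + A I12 I32 * A I13 I21 =
      2 * (q I21 - q I13)"
    "A I12 I13 * A I23 I31 - A I12 I23 * A I13 I31 + A I12 I31 * A I13 I23 =
      2 * (q I13 + q I23 - q I21 - q I32)"
    "A I12 I13 * A I23 I32 - A I12 I23 * A I13 I32 + A I12 I32 * A I13 I23 =
      2 * (q I32 - q I31)"
    "A I12 I13 * A I31 I32 - A I12 I31 * A I13 I32 + A I12 I32 * A I13 I31 =
      2 * (q I13 + q I31 - q I21 - q I32)"
    "A I12 I21 * A I23 I31 - A I12 I23 * A I21 I31 + A I12 I31 * A I21 I23 =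
      2 * (q I32 - q I13)"
    "A I12 I21 * A I23 I32 - A I12 I23 * A I21 I32 + A I12 I32 * A I21 I23 =
      2 * (q I21 + q I31 - q I23 - q I32)"
    "A I12 I21 * A I31 I32 - A I12 I31 * A I21 I32 + A I12 I32 * A I21 I31 =
      2 * (q I23 + q I32 - q I13 - q I31)"
    "A I12 I23 * A I31 I32 - A I12 I31 * A I23 I32 + A I12 I32 * A I23 I31 =
      2 * (q I21 - q I23)"
    "A I13 I21 * A I23 I31 - A I13 I23 * A I21 I31 + A I13 I31 * A I21 I23 =
      2 * (q I13 + q I23)"
    "A I13 I21 * A I23 I32 - A I13 I23 * A I21 I32 + A I13 I32 * A I21 I23 =
      2 * (- q I21 - q I31)"
    "A I13 I21 * A I31 I32 - A I13 I31 * A I21 I32 + A I13 I32 * A I21 I31 =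
      2 * (q I13 + q I31)"
    "A I13 I23 * A I31 I32 - A I13 I31 * A I23 I32 + A I13 I32 * A I23 I31 =
      2 * (- q I21 - q I32)"
    "A I21 I23 * A I31 I32 - A I21 I31 * A I23 I32 + A I21 I32 * A I23 I31 =
      2 * (q I23 + q I32)"
  unfolding A q by (simp_all add: algebra_simps)

lemma A_mat_eq:
  "A_mat I12 I13 = var I21 + var I23 - var I31 - var I32"
  "A_mat I12 I21 = var I12 + var I31 - var I32 - var I21"
  "A_mat I12 I23 = - var I13 - var I21"
  "A_mat I12 I31 = var I13 + var I32"
  "A_mat I12 I32 = var I21 + var I32 - var I12 - var I23"
  "A_mat I13 I21 = var I12 + var I23"
  "A_mat I13 I23 = var I31 + var I23 - var I13 - var I32"
  "A_mat I13 I31 = var I13 + var I21 - var I23 - var I31"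
  "A_mat I13 I32 = - var I12 - var I31"
  "A_mat I21 I23 = var I12 + var I13 - var I32 - var I31"
  "A_mat I21 I31 = var I12 - var I21 + var I31 - var I13"
  "A_mat I21 I32 = var I23 + var I31"
  "A_mat I23 I31 = - var I21 - var I32"
  "A_mat I23 I32 = var I23 + var I12 - var I13 - var I32"
  "A_mat I31 I32 = var I12 + var I13 - var I21 - var I23"
  by (simp_all add: A_mat_def s_vec_simps lin_add lin_diff lin_uminus lin_axis del: One_nat_def)

lemma quadric_vars:
  "quadric I13 = (var I31 - var I21) * (var I32 - var I12) - var I12 * (var I12 + (var I21 - var I12))"
  "quadric I21 = (var I21 - var I12) * (var I23 - var I32) - var I12 * (var I12 + (var I32 - var I12))"
  "quadric I23 = (var I32 - var I12) * (- var I12 - var I13) - var I12 * (var I12 + (var I23 - var I32))"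
  "quadric I31 = (var I23 - var I32) * (var I31 - var I21) - var I12 * (var I12 + (- var I12 - var I13))"
  "quadric I32 = (- var I12 - var I13) * (var I21 - var I12) - var I12 * (var I12 + (var I31 - var I21))"
  by (simp_all add: quadric_eq lin_add lin_diff lin_uminus lin_axis)

lemmas pfaffian4_eq_quadrics = pfaffian_identities[OF A_mat_eq quadric_vars, folded pfaffian4_def]

lemma A_pfaffians_subset: "A_pfaffians \<subseteq> ideal_generated (quadric ` (- {I12}))"
proof
  fix p assume "p \<in> A_pfaffians"
  then obtain a b c d where p: "p = pfaffian4 (idx_list ! a) (idx_list ! b) (idx_list ! c) (idx_list ! d)"
    and less: "a < b" "b < c" "c < d" "d < 6"
    unfolding A_pfaffians_def by blast
  have "quadric I \<in> ideal_generated (quadric ` (- {I12}))" if "I \<noteq> I12" for I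
    using that by (intro ideal_base) simp
  then have q: "quadric I13 \<in> ideal_generated (quadric ` (- {I12}))"
    "quadric I21 \<in> ideal_generated (quadric ` (- {I12}))"
    "quadric I23 \<in> ideal_generated (quadric ` (- {I12}))"
    "quadric I31 \<in> ideal_generated (quadric ` (- {I12}))"
    "quadric I32 \<in> ideal_generated (quadric ` (- {I12}))"
    by simp_all
  \<comment> \<open>A strictly increasing quadruple below 6 leaves each entry only three values,
    which keeps the case distinction small.\<close>
  have "a \<in> {0, 1, 2}" "b \<in> {1, 2, 3}" "c \<in> {2, 3, 4}" "d \<in> {3, 4, 5}"
    using less by auto
  then show "p \<in> ideal_generated (quadric ` (- {I12}))"
    using less unfolding p idx_list_def
    by (elim insertE emptyE)
      (simp_all del: One_nat_def add: pfaffian4_eq_quadrics,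
       auto intro!: ideal_mult ideal_add ideal_diff sym.span_neg[folded ideal_generated_def] q)
qed

lemma pfaffian4_mem:
  "a < b \<Longrightarrow> b < c \<Longrightarrow> c < d \<Longrightarrow> d < 6 \<Longrightarrow>
    pfaffian4 (idx_list ! a) (idx_list ! b) (idx_list ! c) (idx_list ! d) \<in> ideal_generated A_pfaffians"
  by (rule ideal_base) (auto simp: A_pfaffians_def)

text \<open>Suitable combinations of the expressions of the Pfaffians isolate each quadric with
  coefficient 4, which is invertible over the complex numbers. So the Pfaffians span all five
  quadrics.\<close>

lemma quadric_in_ideal:
  assumes "I \<noteq> I12"
  shows "quadric I \<in> ideal_generated A_pfaffians"
proof -
  have divide4: "p \<in> ideal_generated A_pfaffians" if "4 * p \<in> ideal_generated A_pfaffians" for p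
  proof -
    have "const (1 / 4) * (4 * p) = p"
      unfolding mult.assoc[symmetric] by (simp add: const_one flip: const_numeral const_mult)
    then show ?thesis
      using ideal_mult[OF that, of "const (1 / 4)"] by simp
  qed
  have eq: "4 * quadric I13 = pfaffian4 I12 I13 I21 I23 - pfaffian4 I12 I21 I31 I32 - pfaffian4 I13 I23 I31 I32"
    "4 * quadric I21 = pfaffian4 I12 I21 I23 I32 - pfaffian4 I12 I13 I21 I31 - pfaffian4 I13 I23 I31 I32"
    "4 * quadric I23 = pfaffian4 I21 I23 I31 I32 - pfaffian4 I12 I13 I21 I31 - pfaffian4 I12 I13 I23 I32"
    "4 * quadric I31 = pfaffian4 I21 I23 I31 I32 - pfaffian4 I12 I13 I21 I23 + pfaffian4 I12 I13 I31 I32"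
    "4 * quadric I32 = pfaffian4 I21 I23 I31 I32 + pfaffian4 I12 I13 I21 I31 + pfaffian4 I12 I13 I23 I32"
    by (simp_all add: pfaffian4_eq_quadrics)
  have "pfaffian4 I12 I13 I21 I23 \<in> ideal_generated A_pfaffians"
    "pfaffian4 I12 I13 I21 I31 \<in> ideal_generated A_pfaffians"
    "pfaffian4 I12 I13 I23 I32 \<in> ideal_generated A_pfaffians"
    "pfaffian4 I12 I13 I31 I32 \<in> ideal_generated A_pfaffians"
    "pfaffian4 I12 I21 I23 I32 \<in> ideal_generated A_pfaffians"
    "pfaffian4 I12 I21 I31 I32 \<in> ideal_generated A_pfaffians"
    "pfaffian4 I13 I23 I31 I32 \<in> ideal_generated A_pfaffians"
    "pfaffian4 I21 I23 I31 I32 \<in> ideal_generated A_pfaffians"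
    using pfaffian4_mem[of 0 1 2 3] pfaffian4_mem[of 0 1 2 4] pfaffian4_mem[of 0 1 3 5]
      pfaffian4_mem[of 0 1 4 5] pfaffian4_mem[of 0 2 3 5] pfaffian4_mem[of 0 2 4 5]
      pfaffian4_mem[of 1 3 4 5] pfaffian4_mem[of 2 3 4 5]
    by (simp_all add: idx_list_def)
  then have "4 * quadric I \<in> ideal_generated A_pfaffians"
    using assms by (cases I) (simp_all only: eq simp_thms ideal_add ideal_diff)
  then show ?thesis by (rule divide4)
qed


section \<open>The anticanonical surface\<close>

definition quadric_pt :: "(idx \<Rightarrow> complex) \<Rightarrow> bool" where
  "quadric_pt z \<longleftrightarrow> (\<forall>I. I \<noteq> I12 \<longrightarrow> z I * z (rot (rot I)) = z I12 * (z I12 + z (rot I)))"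

text \<open>The effect of the change of basis on points: evaluating a substituted polynomial at
  \<open>z\<close> is evaluating the original one at \<open>to_cluster z\<close>, as
  \<open>peval_quadric\<close> uses.\<close>

definition to_cluster :: "(idx \<Rightarrow> complex) \<Rightarrow> idx \<Rightarrow> complex" where
  "to_cluster z I = peval z (lin (cluster_vec I))"

definition from_cluster :: "(idx \<Rightarrow> complex) \<Rightarrow> idx \<Rightarrow> complex" where
  "from_cluster z I = peval z (lin (uncluster_vec I))"

lemma to_cluster_simps:
  "to_cluster z I12 = z I12" "to_cluster z I13 = z I31 - z I21" "to_cluster z I21 = z I21 - z I12"
  "to_cluster z I23 = z I32 - z I12" "to_cluster z I31 = z I23 - z I32"
  "to_cluster z I32 = - z I12 - z I13"
  by (simp_all add: to_cluster_def lin_add lin_diff lin_uminus lin_axis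
      pev.eval_add pev.eval_diff pev.eval_uminus pev.eval_var)

lemma from_cluster_simps:
  "from_cluster z I12 = z I12" "from_cluster z I13 = - z I12 - z I32"
  "from_cluster z I21 = z I12 + z I21" "from_cluster z I23 = z I12 + z I23 + z I31"
  "from_cluster z I31 = z I12 + z I13 + z I21" "from_cluster z I32 = z I12 + z I23"
  by (simp_all add: from_cluster_def lin_add lin_diff lin_uminus lin_axis
      pev.eval_add pev.eval_diff pev.eval_uminus pev.eval_var)

lemma from_to_cluster: "from_cluster (to_cluster z) = z"
proof
  show "from_cluster (to_cluster z) I = z I" for I
    by (cases I) (simp_all add: from_cluster_simps to_cluster_simps)
qed

lemma from_cluster_scale: "from_cluster (\<lambda>I. c * z I) I = c * from_cluster z I"
  by (cases I) (simp_all add: from_cluster_simps algebra_simps)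

lemma peval_quadric:
  "peval z (quadric I) = peval (to_cluster z) (cluster_rel I)"
  by (simp add: quadric_def peval_sym_map lin_ext_axis to_cluster_def[abs_def])

lemma peval_uncluster:
  "peval z (sym_map (lin_ext uncluster_vec) p) = peval (from_cluster z) p"
  by (simp add: peval_sym_map lin_ext_axis from_cluster_def[abs_def])

lemma quadric_ptI:
  assumes "z I13 * z I23 = z I12 * (z I12 + z I21)" "z I21 * z I31 = z I12 * (z I12 + z I23)"
    "z I23 * z I32 = z I12 * (z I12 + z I31)" "z I31 * z I13 = z I12 * (z I12 + z I32)"
    "z I32 * z I21 = z I12 * (z I12 + z I13)"
  shows "quadric_pt z"
  unfolding quadric_pt_def
proof (intro allI impI)
  fix I assume "I \<noteq> I12"
  then show "z I * z (rot (rot I)) = z I12 * (z I12 + z (rot I))"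
    using assms by (cases I) simp_all
qed

section \<open>The quadrics vanish on the surface\<close>

lemma cubic_simps:
  "cubic I12 x = x$1 * x$2 * (x$2 - x$3)" "cubic I13 x = x$1 * x$3 * (x$3 - x$2)"
  "cubic I21 x = x$2 * x$1 * (x$1 - x$3)" "cubic I23 x = x$2 * x$3 * (x$3 - x$1)"
  "cubic I31 x = x$3 * x$1 * (x$1 - x$2)" "cubic I32 x = x$3 * x$2 * (x$2 - x$1)"
  by (simp_all add: cubic_def third_def)

lemma to_cluster_cubic:
  "to_cluster (\<lambda>I. cubic I x) I12 = x$1 * x$2 * (x$2 - x$3)"
  "to_cluster (\<lambda>I. cubic I x) I13 = - (x$1 * x$1 * (x$2 - x$3))"
  "to_cluster (\<lambda>I. cubic I x) I21 = x$1 * x$2 * (x$1 - x$2)"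
  "to_cluster (\<lambda>I. cubic I x) I23 = - (x$2 * x$2 * (x$1 - x$3))"
  "to_cluster (\<lambda>I. cubic I x) I31 = - (x$2 * x$3 * (x$2 - x$3))"
  "to_cluster (\<lambda>I. cubic I x) I32 = - (x$1 * (x$2 - x$3) * (x$2 - x$3))"
  by (simp_all add: to_cluster_simps cubic_simps algebra_simps)

lemma quadric_pt_cubic: "quadric_pt (to_cluster (\<lambda>I. cubic I x))"
  by (rule quadric_ptI) (simp_all add: to_cluster_cubic algebra_simps)

text \<open>All six cubics have this shape along a line, so one application of the product rule
  covers them.\<close>

lemma deriv_triple_product:
  fixes a b c a' b' c' :: complex
  shows "deriv (\<lambda>t. (a + t * a') * (b + t * b') * ((b + t * b') - (c + t * c'))) 0 =
    a' * b * (b - c) + a * b' * (b - c) + a * b * (b' - c')"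
  by (rule DERIV_imp_deriv) (auto intro!: derivative_eq_intros simp: algebra_simps)

lemma deriv_cubic:
  "deriv (\<lambda>t. cubic I12 (p + t *s v)) 0 =
    v$1 * p$2 * (p$2 - p$3) + p$1 * v$2 * (p$2 - p$3) + p$1 * p$2 * (v$2 - v$3)"
  "deriv (\<lambda>t. cubic I13 (p + t *s v)) 0 =
    v$1 * p$3 * (p$3 - p$2) + p$1 * v$3 * (p$3 - p$2) + p$1 * p$3 * (v$3 - v$2)"
  "deriv (\<lambda>t. cubic I21 (p + t *s v)) 0 =
    v$2 * p$1 * (p$1 - p$3) + p$2 * v$1 * (p$1 - p$3) + p$2 * p$1 * (v$1 - v$3)"
  "deriv (\<lambda>t. cubic I23 (p + t *s v)) 0 =
    v$2 * p$3 * (p$3 - p$1) + p$2 * v$3 * (p$3 - p$1) + p$2 * p$3 * (v$3 - v$1)"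
  "deriv (\<lambda>t. cubic I31 (p + t *s v)) 0 =
    v$3 * p$1 * (p$1 - p$2) + p$3 * v$1 * (p$1 - p$2) + p$3 * p$1 * (v$1 - v$2)"
  "deriv (\<lambda>t. cubic I32 (p + t *s v)) 0 =
    v$3 * p$2 * (p$2 - p$1) + p$3 * v$2 * (p$2 - p$1) + p$3 * p$2 * (v$2 - v$1)"
  unfolding cubic_simps vector_add_component vector_smult_component deriv_triple_product
  by (rule refl)+

lemma base_point_simps:
  "base_point 1 $ 1 = 1" "base_point 1 $ 2 = 0" "base_point 1 $ 3 = 0"
  "base_point 2 $ 1 = 0" "base_point 2 $ 2 = 1" "base_point 2 $ 3 = 0"
  "base_point 3 $ 1 = 0" "base_point 3 $ 2 = 0" "base_point 3 $ 3 = 1"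
  "base_point 4 $ 1 = 1" "base_point 4 $ 2 = 1" "base_point 4 $ 3 = 1"
  by (simp_all add: base_point_def)

lemma base_index: "i \<in> {1..4} \<longleftrightarrow> i = 1 \<or> i = 2 \<or> i = 3 \<or> i = (4 :: nat)"
  by auto

text \<open>Away from the exceptional curves the relations are identities between cubics. On an
  exceptional curve the sections are the derivatives, linear in the direction \<open>v\<close>; at
  each of the four base points the relations become identities in the coordinates of
  \<open>v\<close>.\<close>

lemma quadric_pt_delPezzo5:
  assumes "z \<in> delPezzo5"
  shows "quadric_pt (to_cluster z)"
proof -
  obtain q where "anticanonical q z"
    using assms by (auto simp: delPezzo5_def)
  then show ?thesis
  proof cases
    case (generic x l)
    then show ?thesis by (simp add: quadric_pt_cubic)
  next
    case (exceptional i x c l v)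
    show ?thesis
      using exceptional(3) unfolding exceptional(2) base_index
      by (elim disjE; intro quadric_ptI)
        (simp_all only: to_cluster_simps deriv_cubic base_point_simps, simp_all add: algebra_simps)
  qed
qed

section \<open>Cluster points come from points of the plane\<close>

lemma blowup_generic:
  assumes "x$1 \<noteq> 0" "x$2 \<noteq> 0" "x$1 \<noteq> x$2"
  shows "(\<lambda>I. cubic I x) \<in> delPezzo5"
proof -
  \<comment> \<open>The line joining a base point to \<open>x\<close> is their cross product. It is
    nonzero because the three inequalities keep \<open>x\<close> away from all four base
    points.\<close>
  define l :: "nat \<Rightarrow> complex ^ 3" where "l i = vector [base_point i $ 2 * x$3 - base_point i $ 3 * x$2,
    base_point i $ 3 * x$1 - base_point i $ 1 * x$3, base_point i $ 1 * x$2 - base_point i $ 2 * x$1]" for i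
  have l: "l i $ 1 = base_point i $ 2 * x$3 - base_point i $ 3 * x$2"
    "l i $ 2 = base_point i $ 3 * x$1 - base_point i $ 1 * x$3"
    "l i $ 3 = base_point i $ 1 * x$2 - base_point i $ 2 * x$1" for i
    by (simp_all add: l_def)
  have "x \<noteq> c *s base_point i" if "i \<in> {1..4}" for i c
    using that assms unfolding base_index
    by (auto simp: vec_eq_iff forall_3 base_point_simps simp del: One_nat_def)
  then have "anticanonical (x, l) (\<lambda>I. cubic I x)"
    by (rule anticanonical.generic)
  moreover have "(x, l) \<in> blowup"
  proof -
    have "l i \<noteq> 0" if "i \<in> {1..4}" for i
      using that assms unfolding base_index
      by (auto simp: vec_eq_iff forall_3 base_point_simps l simp del: One_nat_def)
    moreover have "on_line (l i) (base_point i)" "on_line (l i) x" for i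
      by (simp_all add: on_line_def sum_3 l algebra_simps)
    moreover have "x \<noteq> 0"
      using assms by auto
    ultimately show ?thesis by (simp add: blowup_def)
  qed
  ultimately show ?thesis
    unfolding delPezzo5_def by blast
qed

lemma cluster_pt_on_surface:
  assumes "cluster_pt z"
  obtains k where "k \<noteq> 0" "(\<lambda>I. k * from_cluster z I) \<in> delPezzo5"
proof -
  have nz: "z I \<noteq> 0" for I
    using assms by (simp add: cluster_pt_def)
  have rel: "z I * z (rot (rot I)) = z I12 * (z I12 + z (rot I))" if "I \<noteq> I12" for I
    using assms that by (simp add: cluster_pt_def)
  define a b c where "a = z I13" and "b = z I21" and "c = z I12"
  have r: "a * z I23 = c * (c + b)" "b * z I31 = c * (c + z I23)" "z I32 * b = c * (c + a)"
    using rel[of I13] rel[of I21] rel[of I32] by (simp_all add: a_def b_def c_def)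
  \<comment> \<open>The sum \<open>c + a\<close> is nonzero because \<open>c * (c + a)\<close>
    equals the product of the nonzero coordinates \<open>z I32\<close> and \<open>b\<close>.\<close>
  have abc: "a \<noteq> 0" "b \<noteq> 0" "c \<noteq> 0" "c + a \<noteq> 0"
    using nz r(3) nz[of I32] by (auto simp: a_def b_def c_def)
  \<comment> \<open>By the factored cubics, a / c = - x1 / x2 and b / c = (x1 - x2) / (x2 - x3).
    Solving for the ratios of the coordinates and clearing denominators gives this point.\<close>
  define x :: "complex ^ 3" where "x = vector [- (a * b), c * b, c * b + c * (c + a)]"
  have x: "x$1 = - (a * b)" "x$2 = c * b" "x$3 = c * b + c * (c + a)"
    by (simp_all add: x_def)
  \<comment> \<open>The factor by which the cubics at \<open>x\<close> exceed \<open>z\<close>,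
    found by comparing the coordinate c: the cubic x1 x2 (x2 - x3) equals \<open>k * c\<close> at
    this point.\<close>
  define k where "k = a * b * b * c * (c + a)"
  have "k \<noteq> 0"
    using abc by (simp add: k_def)
  have "x$1 \<noteq> x$2"
  proof
    assume "x$1 = x$2"
    moreover have "b * (c + a) = x$2 - x$1"
      unfolding x by (simp add: algebra_simps)
    ultimately show False using abc by simp
  qed
  then have "(\<lambda>I. cubic I x) \<in> delPezzo5"
    using abc by (intro blowup_generic) (simp_all add: x)
  moreover have "to_cluster (\<lambda>I. cubic I x) = (\<lambda>I. k * z I)"
  proof
    fix I
    have I23: "to_cluster (\<lambda>I. cubic I x) I23 = k * z I23"
    proof -
      have "k * z I23 = b * b * c * (c + a) * (a * z I23)"
        by (simp add: k_def)
      then show ?thesis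
        unfolding r to_cluster_cubic x by (simp add: algebra_simps)
    qed
    have I31: "to_cluster (\<lambda>I. cubic I x) I31 = k * z I31"
    proof -
      have "k * z I31 = b * c * (c + a) * a * (b * z I31)"
        by (simp add: k_def)
      also have "\<dots> = b * c * (c + a) * c * (a * c + a * z I23)"
        unfolding r(2) by (simp add: algebra_simps)
      finally show ?thesis
        unfolding r to_cluster_cubic x by (simp add: algebra_simps)
    qed
    have I32: "to_cluster (\<lambda>I. cubic I x) I32 = k * z I32"
    proof -
      have "k * z I32 = a * b * c * (c + a) * (z I32 * b)"
        by (simp add: k_def)
      then show ?thesis
        unfolding r to_cluster_cubic x by (simp add: algebra_simps)
    qed
    show "to_cluster (\<lambda>I. cubic I x) I = k * z I"
      using I23 I31 I32
      by (cases I) (simp_all add: to_cluster_cubic x k_def a_def b_def c_def algebra_simps)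
  qed
  ultimately have "(\<lambda>I. k * from_cluster z I) \<in> delPezzo5"
    using from_to_cluster[of "\<lambda>I. cubic I x"] by (simp add: from_cluster_scale[abs_def])
  with \<open>k \<noteq> 0\<close> show thesis by (rule that)
qed

text \<open>A form vanishing on the surface is rewritten in cluster coordinates, where it vanishes
  at all cluster points and hence lies in the ideal of the relations; transporting back turns the
  relations into the quadrics. Conversely the quadrics are forms vanishing on the surface, and they
  generate all Pfaffians.\<close>

lemma homogeneous_ideal_delPezzo5:
  "homogeneous_ideal delPezzo5 = ideal_generated A_pfaffians"
proof
  have "p \<in> ideal_generated A_pfaffians"
    if p: "homogeneous d p" "\<And>z. z \<in> delPezzo5 \<Longrightarrow> peval z p = 0" for d p
  proof -
    let ?p = "sym_map (lin_ext uncluster_vec) p"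
    have "peval z ?p = 0" if "cluster_pt z" for z
    proof -
      obtain k where k: "k \<noteq> 0" "(\<lambda>I. k * from_cluster z I) \<in> delPezzo5"
        using cluster_pt_on_surface[OF \<open>cluster_pt z\<close>] by blast
      then show ?thesis
        using p(2)[OF k(2)] peval_scale[OF p(1)] by (simp add: peval_uncluster)
    qed
    then have "?p \<in> ideal_generated cluster_rels"
      by (rule vanishing_imp_in_ideal[OF homogeneous_sym_map[OF p(1)]])
    then have "sym_map (lin_ext cluster_vec) ?p \<in> ideal_generated A_pfaffians"
      by (rule sym_map_ideal) (auto simp: cluster_rels_def simp flip: quadric_def intro: quadric_in_ideal)
    then show ?thesis by (simp add: sym_map_cluster_uncluster)
  qed
  then show "homogeneous_ideal delPezzo5 \<subseteq> ideal_generated A_pfaffians"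
    unfolding homogeneous_ideal_def by (intro ideal_mono_closed) blast
next
  have "quadric I \<in> homogeneous_ideal delPezzo5" if "I \<noteq> I12" for I
  proof -
    have "homogeneous (1 + 1) (cluster_rel I)"
      unfolding cluster_rel_def
      by (intro homogeneous_diff homogeneous_mult homogeneous_add homogeneous_var)
    then have "homogeneous (1 + 1) (quadric I)"
      unfolding quadric_def by (rule homogeneous_sym_map)
    moreover have "peval z (quadric I) = 0" if "z \<in> delPezzo5" for z
      using quadric_pt_delPezzo5[OF that] \<open>I \<noteq> I12\<close>
      by (simp add: peval_quadric peval_cluster_rel quadric_pt_def)
    ultimately show ?thesis
      unfolding homogeneous_ideal_def by (intro ideal_base) blast
  qed
  then have "ideal_generated (quadric ` (- {I12})) \<subseteq> homogeneous_ideal delPezzo5"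
    unfolding homogeneous_ideal_def by (intro ideal_mono_closed) auto
  then show "ideal_generated A_pfaffians \<subseteq> homogeneous_ideal delPezzo5"
    using ideal_mono_closed[OF A_pfaffians_subset] by simp
qed


theorem theorem1p1:
  shows "(\<forall>\<rho>. S5_action \<rho> \<longrightarrow>
            (\<forall>g\<in>carrier (sym_group 5). twisted_action \<rho> g A_tensor = A_tensor)) \<and>
         homogeneous_ideal delPezzo5 = ideal_generated A_pfaffians"
  using A_tensor_invariant homogeneous_ideal_delPezzo5 by blast

end
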